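(* For each $n$, let $x,y\in\mathbb R^n$ be random vectors such that the pairs $(x_i,y_i)$, $i=1,\dots,n$, are i.i.d. with a common law not depending on $n$, where $x_i,y_i$ have mean zero, variance one, $\mathbb E|x_i|^{4+\delta}<\infty$ and $\mathbb E|y_i|^{4+\delta}<\infty$ for some $\delta>0$, and $\mathbb E[x_iy_i]=\rho$ (all vectors being defined on one probability space). Define $\bar x=\sqrt n\,x/\|x\|$ and $\bar y=\sqrt n\,y/\|y\|$, and let $B_n$ be a sequence of (non-random) $n\times n$ real symmetric matrices with $\|B_n\|$ bounded in $n$. Then, as $n\to\infty$, $$n^{-1}\bar x^TB_n\bar y-n^{-1}\rho\,\mathrm{tr}\,B_n\to0\quad\text{almost surely}.$$
   Context: $\|x\|$ is the Euclidean norm of a vector and $\|B_n\|$ the spectral norm of a matrix. If $x=0$ (resp. $y=0$), set $\bar x=0$ (resp. $\bar y=0$). *)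

theory Defs
  imports "HOL-Probability.Probability" "Jordan_Normal_Form.Matrix"
begin

no_notation inner (infix "\<bullet>" 70)
no_notation vec_nth (infixl "$" 90)

definition eucl_norm :: "real vec \<Rightarrow> real" where
  "eucl_norm v = sqrt (v \<bullet> v)"

(* The operator norm induced by the Euclidean norm. The supremum runs over the closed unit ball
   rather than the unit sphere so that it is also meaningful (and 0) for the 0 x 0 matrix. *)
definition spectral_norm :: "real mat \<Rightarrow> real" where
  "spectral_norm A =
     (SUP v \<in> {v \<in> carrier_vec (dim_col A). eucl_norm v \<le> 1}. eucl_norm (A *\<^sub>v v))"

definition mat_trace :: "real mat \<Rightarrow> real" where
  "mat_trace A = (\<Sum>i<dim_row A. A $$ (i, i))"

definition symmetric_mat :: "real mat \<Rightarrow> bool" where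
  "symmetric_mat A \<longleftrightarrow> transpose_mat A = A"

(* Rescaling to the sphere of radius sqrt n, n being the dimension, with 0 sent to 0. *)
definition rescale_vec :: "real vec \<Rightarrow> real vec" where
  "rescale_vec v =
     (if v = 0\<^sub>v (dim_vec v) then 0\<^sub>v (dim_vec v)
      else (sqrt (real (dim_vec v)) / eucl_norm v) \<cdot>\<^sub>v v)"

end

theory Submission
  imports Defs
begin

text \<open>
The vectors belonging to different dimensions may depend on each other in any way, so almost sure
convergence can only come from deviations that are summable over \<open>n\<close>. The lemma
\<open>AE_tendsto_zero_if_summable_expectation\<close> is the form of the Borel-Cantelli argument used
throughout: nonnegative random variables with summable expectations tend to zero almost surely.

Without the rescaling, the normalised form \<open>n\<^sup>-\<^sup>1 x\<^sup>T B y\<close> splits into a diagonal and an off-diagonal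
part. The diagonal part is the average of the independent variables \<open>B\<^sub>i\<^sub>i x\<^sub>i y\<^sub>i\<close>, whose mean is
\<open>\<rho> B\<^sub>i\<^sub>i\<close> and which have a bounded moment of some order \<open>q > 2\<close>, because \<open>x\<^sub>i\<close> and \<open>y\<^sub>i\<close> have moments of
order \<open>2 q > 4\<close>. That is enough for a strong law along arrays (\<open>triangular_array_strong_law\<close>), by
truncation at level \<open>n\<close> and a fourth moment bound.

The off-diagonal part is a martingale when the pairs \<open>(x\<^sub>i, y\<^sub>i)\<close> are revealed one after the other. Its
increments have fourth moments bounded in terms of the norms of the rows and columns of \<open>B\<close>, hence
of the spectral norm, and a recursion bounds the fourth moment of the whole sum by a constant times
\<open>n\<^sup>2\<close> (\<open>off_diagonal_power4_le\<close>). After division by \<open>n\<close> the fourth moment is of order \<open>n\<^sup>-\<^sup>2\<close>, which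
is summable. Both parts together give \<open>bilinear_form_strong_law\<close>.

The rescaling divides the normalised form by \<open>n\<^sup>-\<^sup>1\<^sup>/\<^sup>2 \<parallel>x\<parallel>\<close> and \<open>n\<^sup>-\<^sup>1\<^sup>/\<^sup>2 \<parallel>y\<parallel>\<close>
(\<open>rescaled_bilinear_form\<close>). Both tend to 1 almost surely by the strong law for the squares
(\<open>mean_square_strong_law\<close>), and since \<open>\<rho> n\<^sup>-\<^sup>1 tr B\<close> is bounded, they do not change the limit.
\<close>

section \<open>Almost sure convergence from summable expectations\<close>

text \<open>By monotone convergence the random series \<open>\<Sum>n. f n \<omega>\<close> has finite expectation, hence converges almost
surely, and its terms tend to zero. Nothing is assumed about the joint law of the \<open>f n\<close>, so this
is the tool for passing to the limit along rows that may depend on each other in any way.\<close>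
lemma (in prob_space) AE_tendsto_zero_if_summable_expectation:
  fixes f :: "nat \<Rightarrow> 'a \<Rightarrow> real"
  assumes int: "\<And>n. integrable M (f n)"
    and nonneg: "\<And>n \<omega>. 0 \<le> f n \<omega>"
    and bound: "\<And>n. expectation (f n) \<le> c n"
    and sum: "summable c"
  shows "AE \<omega> in M. (\<lambda>n. f n \<omega>) \<longlonglongrightarrow> 0"
proof -
  have [measurable]: "f n \<in> borel_measurable M" for n
    using int by auto
  have E0: "0 \<le> expectation (f n)" for n
    by (simp add: nonneg)
  have "summable (\<lambda>n. expectation (f n))"
    by (rule summable_comparison_test'[OF sum, where N=0]) (use E0 bound in auto)
  hence "(\<Sum>n. ennreal (expectation (f n))) \<noteq> \<infinity>"
    by (simp add: suminf_ennreal2 E0)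
  moreover have "(\<integral>\<^sup>+\<omega>. (\<Sum>n. ennreal (f n \<omega>)) \<partial>M) = (\<Sum>n. ennreal (expectation (f n)))"
    by (simp add: nn_integral_suminf nn_integral_eq_integral int nonneg)
  ultimately have "AE \<omega> in M. (\<Sum>n. ennreal (f n \<omega>)) \<noteq> \<infinity>"
    by (intro nn_integral_PInf_AE) auto
  thus ?thesis
  proof eventually_elim
    case (elim \<omega>)
    hence "summable (\<lambda>n. f n \<omega>)"
      by (intro summable_suminf_not_top) (auto simp: nonneg)
    thus ?case by (rule summable_LIMSEQ_zero)
  qed
qed

section \<open>Fourth moments and independence\<close>

lemma power_le_one_plus_power4:
  fixes t :: real
  assumes "k \<le> 4"
  shows "\<bar>t ^ k\<bar> \<le> 1 + t ^ 4"
proof (cases "\<bar>t\<bar> \<le> 1")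
  case True
  hence "\<bar>t\<bar> ^ k \<le> 1" by (simp add: power_le_one)
  moreover have "0 \<le> t ^ 4" by simp
  ultimately show ?thesis unfolding power_abs by linarith
next
  case False
  hence "\<bar>t\<bar> ^ k \<le> \<bar>t\<bar> ^ 4" using assms by (intro power_increasing) auto
  thus ?thesis by (simp add: power_abs)
qed

lemma (in prob_space) integrable_power_if_integrable_power4:
  fixes f :: "'a \<Rightarrow> real"
  assumes "f \<in> borel_measurable M" "integrable M (\<lambda>\<omega>. f \<omega> ^ 4)" "k \<le> 4"
  shows "integrable M (\<lambda>\<omega>. f \<omega> ^ k)"
proof (rule Bochner_Integration.integrable_bound)
  show "integrable M (\<lambda>\<omega>. 1 + f \<omega> ^ 4)" using assms by simp
  show "AE \<omega> in M. norm (f \<omega> ^ k) \<le> norm (1 + f \<omega> ^ 4)"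
    using power_le_one_plus_power4[OF assms(3)] by (auto intro!: AE_I2 order_trans[OF _ abs_ge_self])
qed (use assms in measurable)

lemma power4_add_le: "(a + b) ^ 4 \<le> 8 * (a ^ 4 + b ^ 4)" for a b :: real
proof -
  have sq: "(u + v)\<^sup>2 \<le> 2 * (u\<^sup>2 + v\<^sup>2)" for u v :: real
    using zero_le_power2[of "u - v"] by (simp add: power2_eq_square algebra_simps)
  have "(a + b) ^ 4 = ((a + b)\<^sup>2)\<^sup>2" by simp
  also have "\<dots> \<le> (2 * (a\<^sup>2 + b\<^sup>2))\<^sup>2" by (intro power_mono sq) auto
  also have "\<dots> = 4 * (a\<^sup>2 + b\<^sup>2)\<^sup>2" by (simp only: power_mult_distrib) simp
  also have "\<dots> \<le> 4 * (2 * ((a\<^sup>2)\<^sup>2 + (b\<^sup>2)\<^sup>2))" by (intro mult_left_mono sq) auto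
  finally show ?thesis by simp
qed

lemma (in prob_space) integrable_power4_add:
  fixes f g :: "'a \<Rightarrow> real"
  assumes "f \<in> borel_measurable M" "g \<in> borel_measurable M"
    and "integrable M (\<lambda>\<omega>. f \<omega> ^ 4)" "integrable M (\<lambda>\<omega>. g \<omega> ^ 4)"
  shows "integrable M (\<lambda>\<omega>. (f \<omega> + g \<omega>) ^ 4)"
proof (rule Bochner_Integration.integrable_bound)
  show "integrable M (\<lambda>\<omega>. 8 * (f \<omega> ^ 4 + g \<omega> ^ 4))" using assms by simp
  show "AE \<omega> in M. norm ((f \<omega> + g \<omega>) ^ 4) \<le> norm (8 * (f \<omega> ^ 4 + g \<omega> ^ 4))"
    using power4_add_le by (auto intro!: AE_I2 order_trans[OF _ abs_ge_self])
qed (use assms in measurable)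

lemma (in prob_space) second_moment_le_fourth:
  fixes f :: "'a \<Rightarrow> real"
  assumes "f \<in> borel_measurable M" "integrable M (\<lambda>\<omega>. f \<omega> ^ 4)"
    and "expectation (\<lambda>\<omega>. f \<omega> ^ 4) \<le> m" "1 \<le> m"
  shows "expectation (\<lambda>\<omega>. (f \<omega>)\<^sup>2) \<le> m"
proof -
  have le: "t\<^sup>2 \<le> (1 + t ^ 4) / 2" for t :: real
    using zero_le_power2[of "t\<^sup>2 - 1"] by (simp add: power2_eq_square power4_eq_xxxx algebra_simps)
  have "expectation (\<lambda>\<omega>. (f \<omega>)\<^sup>2) \<le> expectation (\<lambda>\<omega>. (1 + f \<omega> ^ 4) / 2)"
    using assms le integrable_power_if_integrable_power4[OF assms(1,2), of 2]
    by (intro integral_mono) auto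
  also have "\<dots> \<le> m" using assms by (simp add: prob_space)
  finally show ?thesis .
qed

lemma (in prob_space) indep_var_powers:
  fixes U V :: "'a \<Rightarrow> real"
  assumes indep: "indep_var borel U borel V"
    and "integrable M (\<lambda>\<omega>. U \<omega> ^ 4)" "integrable M (\<lambda>\<omega>. V \<omega> ^ 4)" "j \<le> 4" "k \<le> 4"
  shows "integrable M (\<lambda>\<omega>. U \<omega> ^ j * V \<omega> ^ k)"
    and "expectation (\<lambda>\<omega>. U \<omega> ^ j * V \<omega> ^ k)
           = expectation (\<lambda>\<omega>. U \<omega> ^ j) * expectation (\<lambda>\<omega>. V \<omega> ^ k)"
proof -
  have meas: "U \<in> borel_measurable M" "V \<in> borel_measurable M"
    using indep_var_rv1[OF indep] indep_var_rv2[OF indep] by auto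
  have "indep_var borel (\<lambda>\<omega>. U \<omega> ^ j) borel (\<lambda>\<omega>. V \<omega> ^ k)"
    using indep_var_compose[OF indep, of "\<lambda>u. u ^ j" borel "\<lambda>v. v ^ k" borel] by (simp add: comp_def)
  moreover have "integrable M (\<lambda>\<omega>. U \<omega> ^ j)" "integrable M (\<lambda>\<omega>. V \<omega> ^ k)"
    using assms meas by (auto intro: integrable_power_if_integrable_power4)
  ultimately show "integrable M (\<lambda>\<omega>. U \<omega> ^ j * V \<omega> ^ k)"
    and "expectation (\<lambda>\<omega>. U \<omega> ^ j * V \<omega> ^ k)
           = expectation (\<lambda>\<omega>. U \<omega> ^ j) * expectation (\<lambda>\<omega>. V \<omega> ^ k)"
    by (auto intro: indep_var_integrable indep_var_lebesgue_integral)
qed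

lemma (in prob_space) expectation_power_add_indep:
  fixes U V :: "'a \<Rightarrow> real"
  assumes indep: "indep_var borel U borel V"
    and int: "integrable M (\<lambda>\<omega>. U \<omega> ^ 4)" "integrable M (\<lambda>\<omega>. V \<omega> ^ 4)" and "m \<le> 4"
  shows "expectation (\<lambda>\<omega>. (U \<omega> + V \<omega>) ^ m) = (\<Sum>k\<le>m. real (m choose k) *
           (expectation (\<lambda>\<omega>. U \<omega> ^ k) * expectation (\<lambda>\<omega>. V \<omega> ^ (m - k))))"
proof -
  have "expectation (\<lambda>\<omega>. (U \<omega> + V \<omega>) ^ m)
      = expectation (\<lambda>\<omega>. \<Sum>k\<le>m. real (m choose k) * (U \<omega> ^ k * V \<omega> ^ (m - k)))"
    by (simp add: binomial_ring mult.assoc)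
  also have "\<dots> = (\<Sum>k\<le>m. real (m choose k) * expectation (\<lambda>\<omega>. U \<omega> ^ k * V \<omega> ^ (m - k)))"
    using \<open>m \<le> 4\<close> by (subst Bochner_Integration.integral_sum)
      (auto intro!: indep_var_powers(1)[OF indep int] integrable_mult_right)
  also have "\<dots> = (\<Sum>k\<le>m. real (m choose k) *
           (expectation (\<lambda>\<omega>. U \<omega> ^ k) * expectation (\<lambda>\<omega>. V \<omega> ^ (m - k))))"
    using \<open>m \<le> 4\<close> by (intro sum.cong refl) (auto simp: indep_var_powers(2)[OF indep int])
  finally show ?thesis .
qed

text \<open>This is Rosenthal's inequality with exponent 4. When one more summand \<open>d\<close> is added to the sum \<open>S\<close>,
the terms of \<open>(d + S) ^ 4\<close> that contain \<open>d\<close> or \<open>S\<close> to the first power have expectation zero, so the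
fourth moment grows by \<open>E d\<^sup>4 + 6 E d\<^sup>2 E S\<^sup>2\<close>; the second term is absorbed by the growth of three
times the square of the variance. The first two moments of the sum are part of the conclusion
because the induction needs them.\<close>
lemma (in prob_space) expectation_sum_power4_le:
  fixes X :: "'i \<Rightarrow> 'a \<Rightarrow> real"
  assumes "finite I"
    and "indep_vars (\<lambda>_. borel) X I"
    and "\<And>i. i \<in> I \<Longrightarrow> expectation (X i) = 0"
    and "\<And>i. i \<in> I \<Longrightarrow> integrable M (\<lambda>\<omega>. X i \<omega> ^ 4)"
  shows "integrable M (\<lambda>\<omega>. (\<Sum>i\<in>I. X i \<omega>) ^ 4) \<and>
     expectation (\<lambda>\<omega>. \<Sum>i\<in>I. X i \<omega>) = 0 \<and>
     expectation (\<lambda>\<omega>. (\<Sum>i\<in>I. X i \<omega>)\<^sup>2) = (\<Sum>i\<in>I. expectation (\<lambda>\<omega>. (X i \<omega>)\<^sup>2)) \<and>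
     expectation (\<lambda>\<omega>. (\<Sum>i\<in>I. X i \<omega>) ^ 4)
       \<le> (\<Sum>i\<in>I. expectation (\<lambda>\<omega>. X i \<omega> ^ 4)) + 3 * (\<Sum>i\<in>I. expectation (\<lambda>\<omega>. (X i \<omega>)\<^sup>2))\<^sup>2"
  using assms
proof (induction I rule: finite_induct)
  case empty
  show ?case by simp
next
  case (insert i I)
  let ?S = "\<lambda>\<omega>. \<Sum>i\<in>I. X i \<omega>" and ?d = "X i"
  let ?v = "\<lambda>i. expectation (\<lambda>\<omega>. (X i \<omega>)\<^sup>2)" and ?f = "\<lambda>i. expectation (\<lambda>\<omega>. X i \<omega> ^ 4)"
  have "indep_vars (\<lambda>_. borel) X I" using insert.prems(1) by (rule indep_vars_subset) auto
  hence IH: "integrable M (\<lambda>\<omega>. ?S \<omega> ^ 4)" "expectation ?S = 0"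
      "expectation (\<lambda>\<omega>. (?S \<omega>)\<^sup>2) = (\<Sum>i\<in>I. ?v i)"
      "expectation (\<lambda>\<omega>. ?S \<omega> ^ 4) \<le> (\<Sum>i\<in>I. ?f i) + 3 * (\<Sum>i\<in>I. ?v i)\<^sup>2"
    using insert.IH insert.prems by auto
  have d: "integrable M (\<lambda>\<omega>. ?d \<omega> ^ 4)" "expectation ?d = 0" using insert.prems by auto
  have ind: "indep_var borel ?d borel ?S"
    using insert.hyps insert.prems(1) by (rule indep_vars_sum)
  note add = expectation_power_add_indep[OF ind d(1) IH(1)]
  have set4: "{..4::nat} = {0,1,2,3,4}" and set2: "{..2::nat} = {0,1,2}" and set1: "{..1::nat} = {0,1}"
    by auto
  have "(4 choose 2) = (6::nat)"
    by (simp add: choose_two)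
  hence E4: "expectation (\<lambda>\<omega>. (?d \<omega> + ?S \<omega>) ^ 4) =
      expectation (\<lambda>\<omega>. ?S \<omega> ^ 4) + 6 * (\<Sum>i\<in>I. ?v i) * ?v i + ?f i"
    using add[of 4] IH(2,3) d(2) unfolding set4 by (simp add: prob_space)
  have E2: "expectation (\<lambda>\<omega>. (?d \<omega> + ?S \<omega>)\<^sup>2) = ?v i + (\<Sum>i\<in>I. ?v i)"
    using add[of 2] IH(2,3) d(2) unfolding set2 by (simp add: prob_space)
  have E1: "expectation (\<lambda>\<omega>. ?d \<omega> + ?S \<omega>) = 0"
    using add[of 1] IH(2) d(2) unfolding set1 by simp
  have int: "integrable M (\<lambda>\<omega>. (?d \<omega> + ?S \<omega>) ^ 4)"
    using indep_var_rv1[OF ind] indep_var_rv2[OF ind] IH(1) d(1)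
    by (intro integrable_power4_add) auto
  have v0: "0 \<le> (?v i)\<^sup>2" by simp
  have "3 * (?v i + (\<Sum>i\<in>I. ?v i))\<^sup>2 =
      3 * (\<Sum>i\<in>I. ?v i)\<^sup>2 + 6 * (\<Sum>i\<in>I. ?v i) * ?v i + 3 * (?v i)\<^sup>2"
    by (simp add: power2_eq_square algebra_simps)
  with IH(4) E4 v0 have "expectation (\<lambda>\<omega>. (?d \<omega> + ?S \<omega>) ^ 4)
      \<le> (?f i + (\<Sum>i\<in>I. ?f i)) + 3 * (?v i + (\<Sum>i\<in>I. ?v i))\<^sup>2"
    by linarith
  thus ?case
    using E1 E2 int insert.hyps by simp
qed

text \<open>For a row or column of a matrix, the squared Euclidean norm \<open>L\<close> controls both terms of Rosenthal's
inequality, whatever the number of entries.\<close>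
lemma (in prob_space) weighted_sum_power4_le:
  fixes X :: "'i \<Rightarrow> 'a \<Rightarrow> real"
  assumes fin: "finite I" and indep: "indep_vars (\<lambda>_. borel) X I"
    and mean: "\<And>i. i \<in> I \<Longrightarrow> expectation (X i) = 0"
    and int: "\<And>i. i \<in> I \<Longrightarrow> integrable M (\<lambda>\<omega>. X i \<omega> ^ 4)"
    and m: "\<And>i. i \<in> I \<Longrightarrow> expectation (\<lambda>\<omega>. X i \<omega> ^ 4) \<le> m" "1 \<le> m"
    and L: "(\<Sum>i\<in>I. (b i)\<^sup>2) \<le> L"
  shows "integrable M (\<lambda>\<omega>. (\<Sum>i\<in>I. b i * X i \<omega>) ^ 4)"
    and "expectation (\<lambda>\<omega>. (\<Sum>i\<in>I. b i * X i \<omega>) ^ 4) \<le> 4 * m\<^sup>2 * L\<^sup>2"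
proof -
  have meas: "X i \<in> borel_measurable M" if "i \<in> I" for i
    using indep that unfolding indep_vars_def by auto
  have indep': "indep_vars (\<lambda>_. borel) (\<lambda>i \<omega>. b i * X i \<omega>) I"
    using indep_vars_compose2[OF indep, of "\<lambda>i t. b i * t" "\<lambda>_. borel"] by simp
  note r = expectation_sum_power4_le[OF fin indep']
  have hyp: "\<And>i. i \<in> I \<Longrightarrow> expectation (\<lambda>\<omega>. b i * X i \<omega>) = 0"
    "\<And>i. i \<in> I \<Longrightarrow> integrable M (\<lambda>\<omega>. (b i * X i \<omega>) ^ 4)"
    using mean int by (auto simp: power_mult_distrib)
  show "integrable M (\<lambda>\<omega>. (\<Sum>i\<in>I. b i * X i \<omega>) ^ 4)"
    using r[OF hyp] by simp
  have L0: "0 \<le> L" using L by (intro order_trans[OF _ L] sum_nonneg) auto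
  have "(\<Sum>i\<in>I. (b i) ^ 4) \<le> (\<Sum>i\<in>I. (b i)\<^sup>2 * (\<Sum>j\<in>I. (b j)\<^sup>2))"
  proof (intro sum_mono)
    fix i assume "i \<in> I"
    hence "(b i)\<^sup>2 \<le> (\<Sum>j\<in>I. (b j)\<^sup>2)"
      using fin by (intro member_le_sum) auto
    hence "(b i)\<^sup>2 * (b i)\<^sup>2 \<le> (b i)\<^sup>2 * (\<Sum>j\<in>I. (b j)\<^sup>2)" by (intro mult_left_mono) auto
    thus "b i ^ 4 \<le> (b i)\<^sup>2 * (\<Sum>j\<in>I. (b j)\<^sup>2)" by (simp add: power2_eq_square power4_eq_xxxx mult.assoc)
  qed
  also have "\<dots> = (\<Sum>i\<in>I. (b i)\<^sup>2)\<^sup>2"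
    by (simp add: power2_eq_square sum_distrib_right)
  also have "\<dots> \<le> L\<^sup>2" using L by (intro power_mono sum_nonneg) auto
  finally have b4: "(\<Sum>i\<in>I. (b i) ^ 4) \<le> L\<^sup>2" .
  have "(\<Sum>i\<in>I. expectation (\<lambda>\<omega>. (b i * X i \<omega>) ^ 4)) = (\<Sum>i\<in>I. b i ^ 4 * expectation (\<lambda>\<omega>. X i \<omega> ^ 4))"
    by (simp add: power_mult_distrib)
  also have "\<dots> \<le> (\<Sum>i\<in>I. b i ^ 4 * m)"
    using m by (intro sum_mono mult_left_mono) auto
  also have "\<dots> \<le> L\<^sup>2 * m"
    using b4 m by (simp flip: sum_distrib_right)
  also have "\<dots> \<le> L\<^sup>2 * m\<^sup>2"
    using m(2) by (intro mult_left_mono) (auto simp: power2_eq_square)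
  finally have four: "(\<Sum>i\<in>I. expectation (\<lambda>\<omega>. (b i * X i \<omega>) ^ 4)) \<le> L\<^sup>2 * m\<^sup>2" .
  have "(\<Sum>i\<in>I. expectation (\<lambda>\<omega>. (b i * X i \<omega>)\<^sup>2)) = (\<Sum>i\<in>I. (b i)\<^sup>2 * expectation (\<lambda>\<omega>. (X i \<omega>)\<^sup>2))"
    by (simp add: power_mult_distrib)
  also have "\<dots> \<le> (\<Sum>i\<in>I. (b i)\<^sup>2 * m)"
    using meas int m by (intro sum_mono mult_left_mono second_moment_le_fourth) auto
  also have "\<dots> \<le> L * m"
    using L m by (simp flip: sum_distrib_right)
  finally have "(\<Sum>i\<in>I. expectation (\<lambda>\<omega>. (b i * X i \<omega>)\<^sup>2))\<^sup>2 \<le> (L * m)\<^sup>2"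
    by (intro power_mono sum_nonneg) auto
  moreover have "expectation (\<lambda>\<omega>. (\<Sum>i\<in>I. b i * X i \<omega>) ^ 4) \<le> (\<Sum>i\<in>I. expectation (\<lambda>\<omega>. (b i * X i \<omega>) ^ 4))
      + 3 * (\<Sum>i\<in>I. expectation (\<lambda>\<omega>. (b i * X i \<omega>)\<^sup>2))\<^sup>2"
    using r[OF hyp] by simp
  ultimately show "expectation (\<lambda>\<omega>. (\<Sum>i\<in>I. b i * X i \<omega>) ^ 4) \<le> 4 * m\<^sup>2 * L\<^sup>2"
    using four by (simp add: power_mult_distrib mult.commute)
qed

lemma borel_measurable_real_pair:
  "fst \<in> borel_measurable (borel :: (real \<times> real) measure)"
  "snd \<in> borel_measurable (borel :: (real \<times> real) measure)"
  by (auto intro!: borel_measurable_continuous_onI continuous_intros)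

lemma (in prob_space) indep_vars_pair_components:
  fixes U V :: "'i \<Rightarrow> 'a \<Rightarrow> real"
  assumes "indep_vars (\<lambda>_. borel) (\<lambda>i \<omega>. (U i \<omega>, V i \<omega>)) I"
  shows "indep_vars (\<lambda>_. borel) U I" "indep_vars (\<lambda>_. borel) V I"
  using indep_vars_compose2[OF assms borel_measurable_real_pair(1)]
    indep_vars_compose2[OF assms borel_measurable_real_pair(2)] by simp_all

lemma (in prob_space) indep_vars_pairD:
  fixes U V :: "'i \<Rightarrow> 'a \<Rightarrow> real"
  assumes "indep_vars (\<lambda>_. borel) (\<lambda>i \<omega>. (U i \<omega>, V i \<omega>)) I" "i \<in> I"
  shows "U i \<in> borel_measurable M" "V i \<in> borel_measurable M"
  using indep_vars_pair_components[OF assms(1)] assms(2) unfolding indep_vars_def by auto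

text \<open>Past and present are disjoint blocks of an independent family, and measurable functions of
independent blocks are independent. The martingale argument below uses independence in this form.\<close>
lemma (in prob_space) indep_var_past_present:
  fixes k n :: nat
  assumes indep: "indep_vars (\<lambda>_. N) W {..<n}" and "k < n"
    and f: "f \<in> PiM {..<k} (\<lambda>_. N) \<rightarrow>\<^sub>M N1" and g: "g \<in> N \<rightarrow>\<^sub>M N2"
  shows "indep_var N1 (\<lambda>\<omega>. f (\<lambda>i\<in>{..<k}. W i \<omega>)) N2 (\<lambda>\<omega>. g (W k \<omega>))"
proof -
  have blocks: "indep_var (PiM {..<k} (\<lambda>_. N)) (\<lambda>\<omega>. \<lambda>i\<in>{..<k}. W i \<omega>)
      (PiM {k} (\<lambda>_. N)) (\<lambda>\<omega>. \<lambda>i\<in>{k}. W i \<omega>)"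
    using \<open>k < n\<close> by (intro indep_var_restrict[OF indep]) auto
  have "(\<lambda>w. g (w k)) \<in> PiM {k} (\<lambda>_. N) \<rightarrow>\<^sub>M N2"
    using g by measurable
  from indep_var_compose[OF blocks f this] show ?thesis
    by (simp add: comp_def)
qed

section \<open>A strong law for triangular arrays\<close>

definition truncate_at :: "real \<Rightarrow> real \<Rightarrow> real" where
  "truncate_at c t = (if \<bar>t\<bar> \<le> c then t else 0)"

lemma truncate_at_measurable [measurable]: "truncate_at c \<in> borel_measurable borel"
  unfolding truncate_at_def by measurable

lemma truncation_error_le:
  assumes "1 < q" "0 < c"
  shows "\<bar>t - truncate_at c t\<bar> \<le> \<bar>t\<bar> powr q * c powr (1 - q)"
proof (cases "\<bar>t\<bar> \<le> c")
  case False
  have "\<bar>t\<bar> = \<bar>t\<bar> powr q * \<bar>t\<bar> powr (1 - q)"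
    using False assms by (simp flip: powr_add)
  also have "\<dots> \<le> \<bar>t\<bar> powr q * c powr (1 - q)"
    using False assms by (intro mult_left_mono powr_mono2') auto
  finally show ?thesis using False by (simp add: truncate_at_def)
qed (simp add: truncate_at_def)

lemma truncate_at_power4_le:
  assumes "q \<le> 4" "0 < c"
  shows "truncate_at c t ^ 4 \<le> \<bar>t\<bar> powr q * c powr (4 - q)"
proof (cases "\<bar>t\<bar> \<le> c \<and> t \<noteq> 0")
  case True
  have "t ^ 4 = \<bar>t\<bar> powr 4" using True by (simp add: powr_numeral)
  also have "\<dots> = \<bar>t\<bar> powr q * \<bar>t\<bar> powr (4 - q)"
    by (simp flip: powr_add)
  also have "\<dots> \<le> \<bar>t\<bar> powr q * c powr (4 - q)"
    using True assms by (intro mult_left_mono powr_mono2) auto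
  finally show ?thesis using True by (simp add: truncate_at_def)
qed (auto simp: truncate_at_def)

lemma truncate_at_square_le:
  assumes "2 \<le> q"
  shows "(truncate_at c t)\<^sup>2 \<le> 1 + \<bar>t\<bar> powr q"
proof -
  have "t\<^sup>2 \<le> 1 + \<bar>t\<bar> powr q"
  proof (cases "\<bar>t\<bar> \<le> 1")
    case True
    hence "t\<^sup>2 \<le> 1" by (simp add: abs_square_le_1)
    thus ?thesis using powr_ge_zero[of "\<bar>t\<bar>" q] by linarith
  next
    case False
    have "t\<^sup>2 = \<bar>t\<bar> powr 2" using False by (simp add: powr_numeral)
    also have "\<dots> \<le> \<bar>t\<bar> powr q" using False assms by (intro powr_mono) auto
    finally show ?thesis by simp
  qed
  thus ?thesis by (auto simp: truncate_at_def intro: order_trans[OF zero_le_power2])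
qed

text \<open>Jensen's inequality, as the nonnegativity of a variance applied twice.\<close>
lemma (in prob_space) expectation_power4_ge:
  fixes T :: "'a \<Rightarrow> real"
  assumes [measurable]: "T \<in> borel_measurable M" and int: "integrable M (\<lambda>\<omega>. T \<omega> ^ 4)"
  shows "(expectation T) ^ 4 \<le> expectation (\<lambda>\<omega>. T \<omega> ^ 4)"
proof -
  have sq: "(expectation f)\<^sup>2 \<le> expectation (\<lambda>\<omega>. (f \<omega>)\<^sup>2)"
    if "integrable M f" "integrable M (\<lambda>\<omega>. (f \<omega>)\<^sup>2)" for f :: "'a \<Rightarrow> real"
    using variance_positive[of f] variance_eq[OF that] by simp
  have T: "integrable M (\<lambda>\<omega>. T \<omega> ^ k)" if "k \<le> 4" for k
    by (rule integrable_power_if_integrable_power4[OF assms that])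
  have "(expectation T) ^ 4 = ((expectation T)\<^sup>2)\<^sup>2" by simp
  also have "\<dots> \<le> (expectation (\<lambda>\<omega>. (T \<omega>)\<^sup>2))\<^sup>2"
    using T[of 1] T[of 2] by (intro power_mono sq) auto
  also have "\<dots> \<le> expectation (\<lambda>\<omega>. ((T \<omega>)\<^sup>2)\<^sup>2)"
    using T[of 2] int by (intro sq) (auto simp flip: power_mult)
  finally show ?thesis by simp
qed

lemma (in prob_space) expectation_centred_power4_le:
  fixes T :: "'a \<Rightarrow> real"
  assumes [measurable]: "T \<in> borel_measurable M" and int: "integrable M (\<lambda>\<omega>. T \<omega> ^ 4)"
  shows "integrable M (\<lambda>\<omega>. (T \<omega> - expectation T) ^ 4)"
    and "expectation (\<lambda>\<omega>. (T \<omega> - expectation T) ^ 4) \<le> 16 * expectation (\<lambda>\<omega>. T \<omega> ^ 4)"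
proof -
  show centred: "integrable M (\<lambda>\<omega>. (T \<omega> - expectation T) ^ 4)"
    using integrable_power4_add[of T "\<lambda>_. - expectation T"] int by simp
  have "expectation (\<lambda>\<omega>. (T \<omega> - expectation T) ^ 4)
      \<le> expectation (\<lambda>\<omega>. 8 * (T \<omega> ^ 4 + expectation T ^ 4))"
    using centred int power4_add_le[of _ "- expectation T"] by (intro integral_mono) auto
  also have "\<dots> = 8 * (expectation (\<lambda>\<omega>. T \<omega> ^ 4) + expectation T ^ 4)"
    using int by (simp add: prob_space)
  also have "\<dots> \<le> 16 * expectation (\<lambda>\<omega>. T \<omega> ^ 4)"
    using expectation_power4_ge[OF assms] by simp
  finally show "expectation (\<lambda>\<omega>. (T \<omega> - expectation T) ^ 4) \<le> 16 * expectation (\<lambda>\<omega>. T \<omega> ^ 4)" .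
qed

lemma summable_nat_powr:
  assumes "s < -1"
  shows "summable (\<lambda>n. real n powr s)"
  using assms by (simp add: summable_real_powr_iff)

text \<open>Variables of different rows may depend on each other, so it is not enough that the row averages are
small in probability: their deviations must be summable over the rows. Truncate each entry of row
\<open>n\<close> at level \<open>n\<close>. The average \<open>H n\<close> of the truncation errors has expectation of order
\<open>n powr (1 - q)\<close>. The average \<open>G n\<close> of the centred truncated entries has, by Rosenthal's
inequality, a fourth moment of order \<open>n powr (1 - q) + n powr (-2)\<close>: the truncated entries have
fourth moments of order \<open>n powr (4 - q)\<close> and bounded variances. Both bounds are summable because
\<open>q > 2\<close>.\<close>
lemma (in prob_space) triangular_array_strong_law:
  fixes Y :: "nat \<Rightarrow> nat \<Rightarrow> 'a \<Rightarrow> real"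
  assumes q: "2 < q" "q \<le> 4"
    and indep: "\<And>n. indep_vars (\<lambda>_. borel) (Y n) {..<n}"
    and int: "\<And>n i. i < n \<Longrightarrow> integrable M (\<lambda>\<omega>. \<bar>Y n i \<omega>\<bar> powr q)"
    and bound: "\<And>n i. i < n \<Longrightarrow> expectation (\<lambda>\<omega>. \<bar>Y n i \<omega>\<bar> powr q) \<le> m"
  shows "AE \<omega> in M. (\<lambda>n. (\<Sum>i<n. Y n i \<omega> - expectation (Y n i)) / real n) \<longlonglongrightarrow> 0"
proof -
  let ?T = "\<lambda>n i \<omega>. truncate_at (real n) (Y n i \<omega>)"
  let ?c = "\<lambda>n i. expectation (?T n i)"
  define G where "G = (\<lambda>n \<omega>. (\<Sum>i<n. ?T n i \<omega> - ?c n i) / real n)"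
  define H where "H = (\<lambda>n \<omega>. (\<Sum>i<n. \<bar>Y n i \<omega> - ?T n i \<omega>\<bar>) / real n)"
  have meas: "Y n i \<in> borel_measurable M" if "i < n" for n i
    using indep[of n] that unfolding indep_vars_def by auto
  have m0: "0 \<le> m"
    using bound[of 0 1] by (intro order_trans[OF _ bound[of 0 1]]) auto
  have Tmeas: "?T n i \<in> borel_measurable M" if "i < n" for n i
    using meas[OF that] by measurable
  have Tint: "integrable M (\<lambda>\<omega>. ?T n i \<omega> ^ k)" if "i < n" for n i k
  proof (rule integrable_const_bound)
    show "AE \<omega> in M. norm (?T n i \<omega> ^ k) \<le> real n ^ k"
      by (auto simp: truncate_at_def power_abs intro!: AE_I2 power_mono)
  qed (use Tmeas[OF that] in measurable)
  have err_int: "integrable M (\<lambda>\<omega>. Y n i \<omega> - ?T n i \<omega>)"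
    and err_le: "expectation (\<lambda>\<omega>. \<bar>Y n i \<omega> - ?T n i \<omega>\<bar>) \<le> m * real n powr (1 - q)"
    if "i < n" for n i
  proof -
    have dom: "integrable M (\<lambda>\<omega>. \<bar>Y n i \<omega>\<bar> powr q * real n powr (1 - q))"
      using int[OF that] by simp
    have le: "\<bar>Y n i \<omega> - ?T n i \<omega>\<bar> \<le> \<bar>Y n i \<omega>\<bar> powr q * real n powr (1 - q)" for \<omega>
      using truncation_error_le[of q "real n" "Y n i \<omega>"] q that by simp
    show err: "integrable M (\<lambda>\<omega>. Y n i \<omega> - ?T n i \<omega>)"
    proof (rule Bochner_Integration.integrable_bound[OF dom])
      show "(\<lambda>\<omega>. Y n i \<omega> - ?T n i \<omega>) \<in> borel_measurable M"
        using meas[OF that] by measurable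
      show "AE \<omega> in M. norm (Y n i \<omega> - ?T n i \<omega>) \<le> norm (\<bar>Y n i \<omega>\<bar> powr q * real n powr (1 - q))"
        using le by (auto intro!: AE_I2 order_trans[OF _ abs_ge_self])
    qed
    have "expectation (\<lambda>\<omega>. \<bar>Y n i \<omega> - ?T n i \<omega>\<bar>)
        \<le> expectation (\<lambda>\<omega>. \<bar>Y n i \<omega>\<bar> powr q * real n powr (1 - q))"
      using err dom le by (intro integral_mono) auto
    also have "\<dots> = expectation (\<lambda>\<omega>. \<bar>Y n i \<omega>\<bar> powr q) * real n powr (1 - q)"
      by simp
    also have "\<dots> \<le> m * real n powr (1 - q)"
      using bound[OF that] by (intro mult_right_mono) auto
    finally show "expectation (\<lambda>\<omega>. \<bar>Y n i \<omega> - ?T n i \<omega>\<bar>) \<le> m * real n powr (1 - q)" .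
  qed
  have Yint: "integrable M (Y n i)" if "i < n" for n i
    using Bochner_Integration.integrable_add[OF err_int[OF that] Tint[OF that, of 1]] by simp
  have Eerr: "\<bar>expectation (Y n i) - ?c n i\<bar> \<le> m * real n powr (1 - q)" if "i < n" for n i
  proof -
    have "expectation (Y n i) - ?c n i = expectation (\<lambda>\<omega>. Y n i \<omega> - ?T n i \<omega>)"
      using Yint[OF that] Tint[OF that, of 1] by simp
    also have "\<bar>\<dots>\<bar> \<le> expectation (\<lambda>\<omega>. \<bar>Y n i \<omega> - ?T n i \<omega>\<bar>)"
      by (rule integral_abs_bound)
    finally show ?thesis using err_le[OF that] by linarith
  qed

  have "AE \<omega> in M. (\<lambda>n. H n \<omega>) \<longlonglongrightarrow> 0"
  proof (rule AE_tendsto_zero_if_summable_expectation)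
    show "integrable M (H n)" for n
      unfolding H_def using err_int by (intro integrable_divide Bochner_Integration.integrable_sum) auto
    show "0 \<le> H n \<omega>" for n \<omega>
      unfolding H_def by (simp add: sum_nonneg)
    show "expectation (H n) \<le> m * real n powr (1 - q)" for n
    proof -
      have "expectation (H n) = (\<Sum>i<n. expectation (\<lambda>\<omega>. \<bar>Y n i \<omega> - ?T n i \<omega>\<bar>)) / real n"
        unfolding H_def using err_int by (simp add: Bochner_Integration.integral_sum)
      also have "\<dots> \<le> (\<Sum>i<n. m * real n powr (1 - q)) / real n"
        using err_le by (intro divide_right_mono sum_mono) auto
      also have "\<dots> \<le> m * real n powr (1 - q)"
        using m0 by (cases "n = 0") auto
      finally show ?thesis .
    qed
    show "summable (\<lambda>n. m * real n powr (1 - q))"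
      using q by (intro summable_mult summable_nat_powr) auto
  qed
  moreover have "AE \<omega> in M. (\<lambda>n. G n \<omega> ^ 4) \<longlonglongrightarrow> 0"
  proof (rule AE_tendsto_zero_if_summable_expectation)
    define Z where "Z = (\<lambda>n i \<omega>. ?T n i \<omega> - ?c n i)"
    have Gpow: "G n \<omega> ^ 4 = (\<Sum>i<n. Z n i \<omega>) ^ 4 / real n ^ 4" for n \<omega>
      by (simp add: G_def Z_def power_divide)
    have Zindep: "indep_vars (\<lambda>_. borel) (Z n) {..<n}" for n
      unfolding Z_def
      using indep_vars_compose2[OF indep, where Y="\<lambda>i t. truncate_at (real n) t - ?c n i" and N="\<lambda>_. borel"]
      by simp
    have Zmean: "expectation (Z n i) = 0" if "i < n" for n i
      unfolding Z_def using Tint[OF that, of 1] by (simp add: prob_space)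
    have Z4: "integrable M (\<lambda>\<omega>. Z n i \<omega> ^ 4)"
      "expectation (\<lambda>\<omega>. Z n i \<omega> ^ 4) \<le> 16 * m * real n powr (4 - q)" if "i < n" for n i
    proof -
      note c4 = expectation_centred_power4_le[OF Tmeas[OF that] Tint[OF that, of 4]]
      show "integrable M (\<lambda>\<omega>. Z n i \<omega> ^ 4)" unfolding Z_def by (rule c4)
      have "expectation (\<lambda>\<omega>. ?T n i \<omega> ^ 4) \<le> expectation (\<lambda>\<omega>. \<bar>Y n i \<omega>\<bar> powr q * real n powr (4 - q))"
        using Tint[OF that] int[OF that] truncate_at_power4_le[of q "real n"] q that
        by (intro integral_mono) auto
      also have "\<dots> = expectation (\<lambda>\<omega>. \<bar>Y n i \<omega>\<bar> powr q) * real n powr (4 - q)"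
        by simp
      also have "\<dots> \<le> m * real n powr (4 - q)"
        using bound[OF that] by (intro mult_right_mono) auto
      finally show "expectation (\<lambda>\<omega>. Z n i \<omega> ^ 4) \<le> 16 * m * real n powr (4 - q)"
        using c4(2) unfolding Z_def by linarith
    qed
    have Z2: "expectation (\<lambda>\<omega>. (Z n i \<omega>)\<^sup>2) \<le> 1 + m" if "i < n" for n i
    proof -
      have "expectation (\<lambda>\<omega>. (Z n i \<omega>)\<^sup>2) = expectation (\<lambda>\<omega>. (?T n i \<omega>)\<^sup>2) - (?c n i)\<^sup>2"
        unfolding Z_def using Tint[OF that, of 1] Tint[OF that, of 2] by (simp add: variance_eq)
      also have "\<dots> \<le> expectation (\<lambda>\<omega>. (?T n i \<omega>)\<^sup>2)" by simp
      also have "\<dots> \<le> expectation (\<lambda>\<omega>. 1 + \<bar>Y n i \<omega>\<bar> powr q)"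
        using Tint[OF that] int[OF that] truncate_at_square_le[of q] q
        by (intro integral_mono) auto
      also have "\<dots> \<le> 1 + m"
        using int[OF that] bound[OF that] by (simp add: prob_space)
      finally show ?thesis .
    qed
    have sum4: "integrable M (\<lambda>\<omega>. (\<Sum>i<n. Z n i \<omega>) ^ 4)"
      "expectation (\<lambda>\<omega>. (\<Sum>i<n. Z n i \<omega>) ^ 4)
         \<le> real n * (16 * m * real n powr (4 - q)) + 3 * (real n * (1 + m))\<^sup>2" for n
    proof -
      note r = expectation_sum_power4_le[OF finite_lessThan Zindep[of n]]
      show "integrable M (\<lambda>\<omega>. (\<Sum>i<n. Z n i \<omega>) ^ 4)"
        using r Zmean Z4(1) by auto
      have "(\<Sum>i<n. expectation (\<lambda>\<omega>. Z n i \<omega> ^ 4)) \<le> (\<Sum>i<n. 16 * m * real n powr (4 - q))"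
        using Z4(2) by (intro sum_mono) auto
      moreover have "(\<Sum>i<n. expectation (\<lambda>\<omega>. (Z n i \<omega>)\<^sup>2))\<^sup>2 \<le> (\<Sum>i<n. 1 + m)\<^sup>2"
        using Z2 by (intro power_mono sum_mono sum_nonneg) auto
      ultimately show "expectation (\<lambda>\<omega>. (\<Sum>i<n. Z n i \<omega>) ^ 4)
         \<le> real n * (16 * m * real n powr (4 - q)) + 3 * (real n * (1 + m))\<^sup>2"
        using r Zmean Z4(1) by fastforce
    qed
    show "integrable M (\<lambda>\<omega>. G n \<omega> ^ 4)" for n
      unfolding Gpow using sum4(1)[of n] by simp
    show "0 \<le> G n \<omega> ^ 4" for n \<omega> by simp
    show "expectation (\<lambda>\<omega>. G n \<omega> ^ 4)
        \<le> 16 * m * real n powr (1 - q) + 3 * (1 + m)\<^sup>2 * real n powr (-2)" for n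
    proof (cases "n = 0")
      case False
      have "expectation (\<lambda>\<omega>. G n \<omega> ^ 4) = expectation (\<lambda>\<omega>. (\<Sum>i<n. Z n i \<omega>) ^ 4) / real n ^ 4"
        unfolding Gpow by simp
      also have "\<dots> \<le> (real n * (16 * m * real n powr (4 - q)) + 3 * (real n * (1 + m))\<^sup>2) / real n ^ 4"
        by (intro divide_right_mono sum4(2)) auto
      also have "\<dots> = 16 * m * (real n powr (4 - q) / real n ^ 3) + 3 * (1 + m)\<^sup>2 * (1 / real n ^ 2)"
        using False by (simp add: field_simps power4_eq_xxxx power3_eq_cube power2_eq_square)
      also have "real n powr (4 - q) / real n ^ 3 = real n powr (1 - q)"
      proof -
        have "1 - q = (4 - q) - 3" by simp
        hence "real n powr (1 - q) = real n powr (4 - q) / real n powr 3"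
          by (simp only: powr_diff)
        moreover have "real n powr 3 = real n ^ 3"
          using powr_realpow[of "real n" 3] False by simp
        ultimately show ?thesis by simp
      qed
      also have "1 / real n ^ 2 = real n powr (-2)"
        using False powr_minus[of "real n" 2] by (simp add: powr_numeral divide_inverse)
      finally show ?thesis .
    qed (simp add: G_def)
    show "summable (\<lambda>n. 16 * m * real n powr (1 - q) + 3 * (1 + m)\<^sup>2 * real n powr (-2))"
      using q by (intro summable_add summable_mult summable_nat_powr) auto
  qed
  ultimately show ?thesis
  proof eventually_elim
    case (elim \<omega>)
    have G: "(\<lambda>n. \<bar>G n \<omega>\<bar>) \<longlonglongrightarrow> 0"
      by (rule tendsto_rabs_zero, rule power_tendsto_0_iff[THEN iffD1, OF _ elim(2)]) simp
    have "(\<lambda>n. real n powr (1 - q)) \<longlonglongrightarrow> 0"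
      using q by (intro summable_LIMSEQ_zero summable_nat_powr) auto
    hence lim: "(\<lambda>n. H n \<omega> + m * real n powr (1 - q) + \<bar>G n \<omega>\<bar>) \<longlonglongrightarrow> 0"
      using tendsto_add[OF tendsto_add[OF elim(1) tendsto_mult_right_zero] G, of _ m] by simp
    show ?case
    proof (rule tendsto_rabs_zero_cancel, rule tendsto_sandwich[OF _ _ tendsto_const lim])
      show "\<forall>\<^sub>F n in sequentially. 0 \<le> \<bar>(\<Sum>i<n. Y n i \<omega> - expectation (Y n i)) / real n\<bar>"
        by simp
      have "\<bar>(\<Sum>i<n. Y n i \<omega> - expectation (Y n i)) / real n\<bar>
          \<le> H n \<omega> + m * real n powr (1 - q) + \<bar>G n \<omega>\<bar>" for n
      proof -
        have "(\<Sum>i<n. Y n i \<omega> - expectation (Y n i)) / real n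
            = (\<Sum>i<n. Y n i \<omega> - ?T n i \<omega>) / real n + (\<Sum>i<n. ?c n i - expectation (Y n i)) / real n + G n \<omega>"
          by (simp add: G_def sum_subtractf diff_divide_distrib)
        moreover have "\<bar>(\<Sum>i<n. Y n i \<omega> - ?T n i \<omega>) / real n\<bar> \<le> H n \<omega>"
          unfolding H_def by (simp add: sum_abs divide_right_mono)
        moreover have "\<bar>\<Sum>i<n. ?c n i - expectation (Y n i)\<bar> \<le> (\<Sum>i<n. m * real n powr (1 - q))"
          by (intro order_trans[OF sum_abs] sum_mono) (use Eerr in \<open>simp add: abs_minus_commute\<close>)
        hence "\<bar>(\<Sum>i<n. ?c n i - expectation (Y n i)) / real n\<bar> \<le> m * real n powr (1 - q)"
          using m0 by (cases "n = 0") (auto simp: field_simps)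
        ultimately show ?thesis by linarith
      qed
      thus "\<forall>\<^sub>F n in sequentially. \<bar>(\<Sum>i<n. Y n i \<omega> - expectation (Y n i)) / real n\<bar>
          \<le> H n \<omega> + m * real n powr (1 - q) + \<bar>G n \<omega>\<bar>"
        by simp
    qed
  qed
qed

text \<open>A product therefore has a moment of order \<open>q\<close> as soon as both factors have moments of order \<open>2 * q\<close>.\<close>
lemma powr_product_le:
  fixes s t q :: real
  assumes "0 \<le> q"
  shows "\<bar>s * t\<bar> powr q \<le> \<bar>s\<bar> powr (2 * q) + \<bar>t\<bar> powr (2 * q)"
proof -
  have "0 \<le> (\<bar>s\<bar> powr q - \<bar>t\<bar> powr q)\<^sup>2" by simp
  hence "2 * (\<bar>s\<bar> powr q * \<bar>t\<bar> powr q) \<le> (\<bar>s\<bar> powr q)\<^sup>2 + (\<bar>t\<bar> powr q)\<^sup>2"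
    by (simp add: power2_eq_square algebra_simps)
  also have "\<dots> = \<bar>s\<bar> powr (2 * q) + \<bar>t\<bar> powr (2 * q)"
    by (simp add: power2_eq_square flip: powr_add)
  finally have "2 * (\<bar>s\<bar> powr q * \<bar>t\<bar> powr q) \<le> \<bar>s\<bar> powr (2 * q) + \<bar>t\<bar> powr (2 * q)" .
  moreover have "0 \<le> \<bar>s\<bar> powr q * \<bar>t\<bar> powr q" by simp
  moreover have "\<bar>s * t\<bar> powr q = \<bar>s\<bar> powr q * \<bar>t\<bar> powr q"
    by (simp add: abs_mult powr_mult)
  ultimately show ?thesis by linarith
qed

lemma powr_le_one_plus_powr:
  fixes t :: real
  assumes "0 \<le> r" "r \<le> p"
  shows "\<bar>t\<bar> powr r \<le> 1 + \<bar>t\<bar> powr p"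
proof (cases "\<bar>t\<bar> \<le> 1")
  case True
  hence "\<bar>t\<bar> powr r \<le> 1" using assms by (simp add: powr_le1)
  thus ?thesis using powr_ge_zero[of "\<bar>t\<bar>" p] by linarith
next
  case False
  hence "\<bar>t\<bar> powr r \<le> \<bar>t\<bar> powr p" using assms by (intro powr_mono) auto
  thus ?thesis by simp
qed

lemma (in prob_space) expectation_powr_le:
  fixes f :: "'a \<Rightarrow> real"
  assumes [measurable]: "f \<in> borel_measurable M" and int: "integrable M (\<lambda>\<omega>. \<bar>f \<omega>\<bar> powr p)"
    and "0 \<le> r" "r \<le> p"
  shows "integrable M (\<lambda>\<omega>. \<bar>f \<omega>\<bar> powr r)"
    and "expectation (\<lambda>\<omega>. \<bar>f \<omega>\<bar> powr r) \<le> 1 + expectation (\<lambda>\<omega>. \<bar>f \<omega>\<bar> powr p)"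
proof -
  have dom: "integrable M (\<lambda>\<omega>. 1 + \<bar>f \<omega>\<bar> powr p)" using int by simp
  show r: "integrable M (\<lambda>\<omega>. \<bar>f \<omega>\<bar> powr r)"
    using powr_le_one_plus_powr[OF assms(3,4)]
    by (intro Bochner_Integration.integrable_bound[OF dom]) (auto intro: order_trans[OF _ abs_ge_self])
  have "expectation (\<lambda>\<omega>. \<bar>f \<omega>\<bar> powr r) \<le> expectation (\<lambda>\<omega>. 1 + \<bar>f \<omega>\<bar> powr p)"
    using r dom powr_le_one_plus_powr[OF assms(3,4)] by (intro integral_mono) auto
  thus "expectation (\<lambda>\<omega>. \<bar>f \<omega>\<bar> powr r) \<le> 1 + expectation (\<lambda>\<omega>. \<bar>f \<omega>\<bar> powr p)"
    using int by (simp add: prob_space)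
qed

text \<open>With the diagonal entries of a matrix as weights \<open>b\<close>, the sum is the diagonal part of a bilinear
form; with \<open>U = V\<close> and weights 1 it is the squared norm of a random vector.\<close>
lemma (in prob_space) weighted_products_strong_law:
  fixes U V :: "nat \<Rightarrow> nat \<Rightarrow> 'a \<Rightarrow> real" and b :: "nat \<Rightarrow> nat \<Rightarrow> real"
  assumes q: "2 < q" "q \<le> 4"
    and indep: "\<And>n. indep_vars (\<lambda>_. borel) (\<lambda>i \<omega>. (U n i \<omega>, V n i \<omega>)) {..<n}"
    and U: "\<And>n i. i < n \<Longrightarrow> integrable M (\<lambda>\<omega>. \<bar>U n i \<omega>\<bar> powr (2 * q))"
      "\<And>n i. i < n \<Longrightarrow> expectation (\<lambda>\<omega>. \<bar>U n i \<omega>\<bar> powr (2 * q)) \<le> m"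
    and V: "\<And>n i. i < n \<Longrightarrow> integrable M (\<lambda>\<omega>. \<bar>V n i \<omega>\<bar> powr (2 * q))"
      "\<And>n i. i < n \<Longrightarrow> expectation (\<lambda>\<omega>. \<bar>V n i \<omega>\<bar> powr (2 * q)) \<le> m"
    and b: "\<And>n i. i < n \<Longrightarrow> \<bar>b n i\<bar> \<le> K"
  shows "AE \<omega> in M. (\<lambda>n. (\<Sum>i<n. b n i * (U n i \<omega> * V n i \<omega>)
            - b n i * expectation (\<lambda>\<omega>. U n i \<omega> * V n i \<omega>)) / real n) \<longlonglongrightarrow> 0"
proof -
  define Y where "Y = (\<lambda>n i \<omega>. b n i * (U n i \<omega> * V n i \<omega>))"
  have indepY: "indep_vars (\<lambda>_. borel) (Y n) {..<n}" for n
  proof -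
    have "(\<lambda>p. b n i * (fst p * snd p)) \<in> borel_measurable (borel :: (real \<times> real) measure)" for i
      using borel_measurable_real_pair by measurable
    from indep_vars_compose2[OF indep this] show ?thesis by (simp add: Y_def)
  qed
  have moment: "integrable M (\<lambda>\<omega>. \<bar>Y n i \<omega>\<bar> powr q)"
    "expectation (\<lambda>\<omega>. \<bar>Y n i \<omega>\<bar> powr q) \<le> K powr q * (2 * m)" if i: "i < n" for n i
  proof -
    let ?D = "\<lambda>\<omega>. K powr q * (\<bar>U n i \<omega>\<bar> powr (2 * q) + \<bar>V n i \<omega>\<bar> powr (2 * q))"
    have le: "\<bar>Y n i \<omega>\<bar> powr q \<le> ?D \<omega>" for \<omega>
    proof -
      have "\<bar>Y n i \<omega>\<bar> powr q = \<bar>b n i\<bar> powr q * \<bar>U n i \<omega> * V n i \<omega>\<bar> powr q"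
        by (simp add: Y_def abs_mult powr_mult)
      also have "\<dots> \<le> ?D \<omega>"
        using q b[OF i] by (intro mult_mono powr_mono2 powr_product_le) auto
      finally show ?thesis .
    qed
    have dom: "integrable M ?D" using U(1)[OF i] V(1)[OF i] by simp
    have [measurable]: "Y n i \<in> borel_measurable M"
      using indepY[of n] i unfolding indep_vars_def by auto
    show int: "integrable M (\<lambda>\<omega>. \<bar>Y n i \<omega>\<bar> powr q)"
      using le by (intro Bochner_Integration.integrable_bound[OF dom])
        (auto intro: order_trans[OF _ abs_ge_self] simp del: abs_mult)
    have "expectation (\<lambda>\<omega>. \<bar>Y n i \<omega>\<bar> powr q) \<le> expectation ?D"
      using int dom le by (intro integral_mono) auto
    also have "\<dots> = K powr q * (expectation (\<lambda>\<omega>. \<bar>U n i \<omega>\<bar> powr (2 * q))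
        + expectation (\<lambda>\<omega>. \<bar>V n i \<omega>\<bar> powr (2 * q)))"
      using U(1)[OF i] V(1)[OF i] by simp
    also have "\<dots> \<le> K powr q * (2 * m)"
      using U(2)[OF i] V(2)[OF i] by (intro mult_left_mono) auto
    finally show "expectation (\<lambda>\<omega>. \<bar>Y n i \<omega>\<bar> powr q) \<le> K powr q * (2 * m)" .
  qed
  have "expectation (Y n i) = b n i * expectation (\<lambda>\<omega>. U n i \<omega> * V n i \<omega>)" for n i
    by (simp add: Y_def)
  with triangular_array_strong_law[OF q indepY moment] show ?thesis
    by (simp add: Y_def)
qed

lemma (in prob_space) mean_square_strong_law:
  fixes X :: "nat \<Rightarrow> nat \<Rightarrow> 'a \<Rightarrow> real"
  assumes q: "2 < q" "q \<le> 4"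
    and indep: "\<And>n. indep_vars (\<lambda>_. borel) (X n) {..<n}"
    and X: "\<And>n i. i < n \<Longrightarrow> integrable M (\<lambda>\<omega>. \<bar>X n i \<omega>\<bar> powr (2 * q))"
      "\<And>n i. i < n \<Longrightarrow> expectation (\<lambda>\<omega>. \<bar>X n i \<omega>\<bar> powr (2 * q)) \<le> m"
    and second: "\<And>n i. i < n \<Longrightarrow> expectation (\<lambda>\<omega>. (X n i \<omega>)\<^sup>2) = 1"
  shows "AE \<omega> in M. (\<lambda>n. (\<Sum>i<n. (X n i \<omega>)\<^sup>2) / real n) \<longlonglongrightarrow> 1"
proof -
  have "indep_vars (\<lambda>_. borel) (\<lambda>i \<omega>. (X n i \<omega>, X n i \<omega>)) {..<n}" for n
  proof -
    have "(\<lambda>t. (t, t)) \<in> borel_measurable (borel :: real measure)"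
      by (intro borel_measurable_Pair) auto
    from indep_vars_compose2[OF indep this] show ?thesis by simp
  qed
  from weighted_products_strong_law[OF q this X X, where b = "\<lambda>_ _. 1" and K = 1]
  have "AE \<omega> in M. (\<lambda>n. (\<Sum>i<n. (X n i \<omega>)\<^sup>2 - expectation (\<lambda>\<omega>. (X n i \<omega>)\<^sup>2)) / real n) \<longlonglongrightarrow> 0"
    by (simp add: power2_eq_square)
  thus ?thesis
  proof eventually_elim
    case (elim \<omega>)
    have "(\<lambda>n. (\<Sum>i<n. (X n i \<omega>)\<^sup>2 - expectation (\<lambda>\<omega>. (X n i \<omega>)\<^sup>2)) / real n + 1) \<longlonglongrightarrow> 0 + 1"
      by (intro tendsto_add elim tendsto_const)
    \<comment> \<open>The rows with \<open>n > 0\<close> only, because the empty row has average 0 and not 1.\<close>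
    moreover have "\<forall>\<^sub>F n in sequentially.
        (\<Sum>i<n. (X n i \<omega>)\<^sup>2 - expectation (\<lambda>\<omega>. (X n i \<omega>)\<^sup>2)) / real n + 1
        = (\<Sum>i<n. (X n i \<omega>)\<^sup>2) / real n"
      using eventually_gt_at_top[of 0]
    proof eventually_elim
      case (elim n)
      thus ?case by (simp add: sum_subtractf second diff_divide_distrib)
    qed
    ultimately show ?case
      by (simp add: tendsto_cong)
  qed
qed

section \<open>The off-diagonal part of a bilinear form\<close>

text \<open>The step of the recursion for fourth moments of a martingale: the term \<open>s\<^sup>3 d\<close> is kept because its
expectation will vanish, while \<open>s\<^sup>2 d\<^sup>2\<close> and \<open>s d\<^sup>3\<close> are split by the inequality between arithmetic
and geometric means. The weight \<open>k\<close> in the split of \<open>s\<^sup>2 d\<^sup>2\<close> balances \<open>s ^ 4\<close>, of order \<open>k\<^sup>2\<close> at time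
\<open>k\<close>, against a bounded \<open>d ^ 4\<close>: both parts are then of order \<open>k\<close>, the size of an increment of
\<open>k\<^sup>2\<close>.\<close>
lemma power4_add_expand_le:
  fixes s d k :: real
  assumes "0 < k"
  shows "(s + d) ^ 4 \<le> (1 + 1 / k) * s ^ 4 + 4 * (s ^ 3 * d) + (16 * k + 3) * d ^ 4"
proof -
  have cubic: "4 * (s * d ^ 3) \<le> 2 * (s\<^sup>2 * d\<^sup>2) + 2 * d ^ 4"
  proof -
    have "0 \<le> 2 * d\<^sup>2 * (s - d)\<^sup>2" by simp
    thus ?thesis by (simp add: power2_eq_square power3_eq_cube power4_eq_xxxx algebra_simps)
  qed
  have "8 * (s\<^sup>2 * d\<^sup>2) \<le> s ^ 4 / k + 16 * k * d ^ 4"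
  proof -
    have "0 \<le> (s\<^sup>2 - 4 * k * d\<^sup>2)\<^sup>2 / k" using assms by simp
    also have "\<dots> = s ^ 4 / k + 16 * k * d ^ 4 - 8 * (s\<^sup>2 * d\<^sup>2)"
      using assms by (simp add: power2_eq_square power4_eq_xxxx field_simps)
    finally show ?thesis by simp
  qed
  moreover have "(s + d) ^ 4 = s ^ 4 + 4 * (s ^ 3 * d) + 6 * (s\<^sup>2 * d\<^sup>2) + 4 * (s * d ^ 3) + d ^ 4"
    by (simp add: power2_eq_square power3_eq_cube power4_eq_xxxx algebra_simps)
  moreover have "(1 + 1 / k) * s ^ 4 + 4 * (s ^ 3 * d) + (16 * k + 3) * d ^ 4
      = s ^ 4 + s ^ 4 / k + 4 * (s ^ 3 * d) + 16 * k * d ^ 4 + 3 * d ^ 4"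
    by (simp add: algebra_simps)
  ultimately show ?thesis using cubic by linarith
qed

lemma abs_cube_mult_le: "\<bar>s ^ 3 * u\<bar> \<le> s ^ 4 + u ^ 4" for s u :: real
proof -
  have "\<bar>s ^ 3 * u\<bar> = \<bar>s\<bar> ^ 3 * \<bar>u\<bar>" by (simp add: abs_mult power_abs)
  also have "\<dots> \<le> max \<bar>s\<bar> \<bar>u\<bar> ^ 3 * max \<bar>s\<bar> \<bar>u\<bar>"
    by (intro mult_mono power_mono) auto
  also have "\<dots> = max \<bar>s\<bar> \<bar>u\<bar> ^ 4" by (simp add: power4_eq_xxxx power3_eq_cube)
  also have "\<dots> \<le> s ^ 4 + u ^ 4" by (simp add: max_def)
  finally show ?thesis .
qed

text \<open>The partial sums \<open>S k\<close> form a martingale with respect to the pairs: the increment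
\<open>d k = X k * U k + Y k * V k\<close> is linear in the new pair, which has mean zero, and its coefficients
\<open>U k\<close> and \<open>V k\<close> depend on the earlier pairs only. Hence the expectation of \<open>(S k) ^ 3 * d k\<close> vanishes. By independence and
the bound for weighted sums, the fourth moment of \<open>d k\<close> is at most \<open>C = 64 m\<^sup>3 L\<^sup>2\<close> for every \<open>k\<close>, so
that only fourth moments of the entries are used. The recursion
\<open>A (k + 1) \<le> (1 + 1 / k) * A k + (16 k + 3) * C\<close> for the fourth moment \<open>A k\<close> of \<open>S k\<close> then gives
\<open>A k \<le> 16 C k\<^sup>2\<close>.\<close>
lemma (in prob_space) off_diagonal_power4_le:
  fixes X Y :: "nat \<Rightarrow> 'a \<Rightarrow> real" and a b :: "nat \<Rightarrow> nat \<Rightarrow> real"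
  assumes indep: "indep_vars (\<lambda>_. borel) (\<lambda>i \<omega>. (X i \<omega>, Y i \<omega>)) {..<n}"
    and mean: "\<And>i. i < n \<Longrightarrow> expectation (X i) = 0" "\<And>i. i < n \<Longrightarrow> expectation (Y i) = 0"
    and int: "\<And>i. i < n \<Longrightarrow> integrable M (\<lambda>\<omega>. X i \<omega> ^ 4)" "\<And>i. i < n \<Longrightarrow> integrable M (\<lambda>\<omega>. Y i \<omega> ^ 4)"
    and m: "\<And>i. i < n \<Longrightarrow> expectation (\<lambda>\<omega>. X i \<omega> ^ 4) \<le> m"
      "\<And>i. i < n \<Longrightarrow> expectation (\<lambda>\<omega>. Y i \<omega> ^ 4) \<le> m" "1 \<le> m"
    and L: "\<And>k. k < n \<Longrightarrow> (\<Sum>j<k. (a k j)\<^sup>2) \<le> L" "\<And>k. k < n \<Longrightarrow> (\<Sum>j<k. (b k j)\<^sup>2) \<le> L"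
    and "k \<le> n"
  defines "S \<equiv> \<lambda>k \<omega>. \<Sum>i<k. X i \<omega> * (\<Sum>j<i. a i j * Y j \<omega>) + Y i \<omega> * (\<Sum>j<i. b i j * X j \<omega>)"
  shows "integrable M (\<lambda>\<omega>. S k \<omega> ^ 4)"
    and "expectation (\<lambda>\<omega>. S k \<omega> ^ 4) \<le> 1024 * m ^ 3 * L\<^sup>2 * (real k)\<^sup>2"
proof -
  let ?W = "\<lambda>i \<omega>. (X i \<omega>, Y i \<omega>)"
  let ?U = "\<lambda>k \<omega>. \<Sum>j<k. a k j * Y j \<omega>" and ?V = "\<lambda>k \<omega>. \<Sum>j<k. b k j * X j \<omega>"
  let ?C = "64 * m ^ 3 * L\<^sup>2"
  have C0: "0 \<le> ?C" using m(3) by simp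
  note fst = borel_measurable_real_pair(1) and snd = borel_measurable_real_pair(2)
  note indepX = indep_vars_pair_components(1)[OF indep]
    and indepY = indep_vars_pair_components(2)[OF indep]
  have meas: "X i \<in> borel_measurable M" "Y i \<in> borel_measurable M" if "i < n" for i
    using indep_vars_pairD[OF indep] that by auto
  have comp: "(\<lambda>w. fst (w i)) \<in> borel_measurable (PiM {..<k} (\<lambda>_. borel :: (real \<times> real) measure))"
    "(\<lambda>w. snd (w i)) \<in> borel_measurable (PiM {..<k} (\<lambda>_. borel :: (real \<times> real) measure))"
    if "i < k" for i k :: nat
    using that by (auto intro!: measurable_compose[OF _ fst] measurable_compose[OF _ snd]
        measurable_component_singleton)

  \<comment> \<open>Stated for an arbitrary function of past quantities because it is used both for the coefficient
    alone (to bound the increment) and for its product with the cube of the partial sum.\<close>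
  have step: "indep_var borel (\<lambda>\<omega>. F (S k \<omega>) (?U k \<omega>)) borel (X k)"
      "indep_var borel (\<lambda>\<omega>. F (S k \<omega>) (?V k \<omega>)) borel (Y k)"
    if k: "k < n" and F: "case_prod F \<in> borel_measurable (borel :: (real \<times> real) measure)"
    for k and F :: "real \<Rightarrow> real \<Rightarrow> real"
  proof -
    let ?P = "PiM {..<k} (\<lambda>_. borel :: (real \<times> real) measure)"
    define s where "s = (\<lambda>w :: nat \<Rightarrow> real \<times> real. \<Sum>i<k. fst (w i) * (\<Sum>j<i. a i j * snd (w j)) + snd (w i) * (\<Sum>j<i. b i j * fst (w j)))"
    define u where "u = (\<lambda>w :: nat \<Rightarrow> real \<times> real. \<Sum>j<k. a k j * snd (w j))"
    define v where "v = (\<lambda>w :: nat \<Rightarrow> real \<times> real. \<Sum>j<k. b k j * fst (w j))"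
    have s: "s \<in> borel_measurable ?P" unfolding s_def
      by (intro borel_measurable_sum borel_measurable_add borel_measurable_times comp
          borel_measurable_const) auto
    have u: "u \<in> borel_measurable ?P" and v: "v \<in> borel_measurable ?P"
      unfolding u_def v_def
      by (auto intro!: borel_measurable_sum borel_measurable_times comp)
    have Fs: "(\<lambda>w. F (s w) (u w)) \<in> borel_measurable ?P" "(\<lambda>w. F (s w) (v w)) \<in> borel_measurable ?P"
      using measurable_compose[OF borel_measurable_Pair[OF s u] F]
        measurable_compose[OF borel_measurable_Pair[OF s v] F] by simp_all
    have "s (\<lambda>i\<in>{..<k}. ?W i \<omega>) = S k \<omega>" "u (\<lambda>i\<in>{..<k}. ?W i \<omega>) = ?U k \<omega>"
      "v (\<lambda>i\<in>{..<k}. ?W i \<omega>) = ?V k \<omega>" for \<omega>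
      unfolding s_def u_def v_def S_def by auto
    thus "indep_var borel (\<lambda>\<omega>. F (S k \<omega>) (?U k \<omega>)) borel (X k)"
      "indep_var borel (\<lambda>\<omega>. F (S k \<omega>) (?V k \<omega>)) borel (Y k)"
      using indep_var_past_present[OF indep k Fs(1) fst] indep_var_past_present[OF indep k Fs(2) snd]
      by simp_all
  qed

  have UV: "integrable M (\<lambda>\<omega>. ?U k \<omega> ^ 4)" "expectation (\<lambda>\<omega>. ?U k \<omega> ^ 4) \<le> 4 * m\<^sup>2 * L\<^sup>2"
    "integrable M (\<lambda>\<omega>. ?V k \<omega> ^ 4)" "expectation (\<lambda>\<omega>. ?V k \<omega> ^ 4) \<le> 4 * m\<^sup>2 * L\<^sup>2"
    if k: "k < n" for k
  proof -
    have "indep_vars (\<lambda>_. borel) X {..<k}" "indep_vars (\<lambda>_. borel) Y {..<k}"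
      using k by (auto intro: indep_vars_subset[OF indepX] indep_vars_subset[OF indepY])
    thus "integrable M (\<lambda>\<omega>. ?U k \<omega> ^ 4)" "expectation (\<lambda>\<omega>. ?U k \<omega> ^ 4) \<le> 4 * m\<^sup>2 * L\<^sup>2"
      "integrable M (\<lambda>\<omega>. ?V k \<omega> ^ 4)" "expectation (\<lambda>\<omega>. ?V k \<omega> ^ 4) \<le> 4 * m\<^sup>2 * L\<^sup>2"
      using k mean int m L[OF k] by (auto intro!: weighted_sum_power4_le)
  qed

  define d where "d = (\<lambda>k \<omega>. X k \<omega> * ?U k \<omega> + Y k \<omega> * ?V k \<omega>)"
  have S_Suc: "S (Suc k) \<omega> = S k \<omega> + d k \<omega>" for k \<omega>
    by (simp add: S_def d_def)
  have Umeas: "?U k \<in> borel_measurable M" "?V k \<in> borel_measurable M" if "k \<le> n" for k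
    using that meas by (auto intro!: borel_measurable_sum borel_measurable_times)
  have dmeas: "d k \<in> borel_measurable M" if "k < n" for k
    unfolding d_def using that meas Umeas[of k] by (intro borel_measurable_add borel_measurable_times) auto
  have Smeas: "S k \<in> borel_measurable M" if "k \<le> n" for k
    unfolding S_def using that meas
    by (auto intro!: borel_measurable_sum borel_measurable_add borel_measurable_times)

  have d4: "integrable M (\<lambda>\<omega>. d k \<omega> ^ 4)" "expectation (\<lambda>\<omega>. d k \<omega> ^ 4) \<le> ?C"
    if k: "k < n" for k
  proof -
    have ind: "indep_var borel (?U k) borel (X k)" "indep_var borel (?V k) borel (Y k)"
      using step[OF k, of "\<lambda>s u. u"] snd by (simp_all add: case_prod_unfold)
    note PX = indep_var_powers[OF ind(1) UV(1)[OF k] int(1)[OF k], of 4 4, simplified]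
    note PY = indep_var_powers[OF ind(2) UV(3)[OF k] int(2)[OF k], of 4 4, simplified]
    have int': "integrable M (\<lambda>\<omega>. (X k \<omega> * ?U k \<omega>) ^ 4)" "integrable M (\<lambda>\<omega>. (Y k \<omega> * ?V k \<omega>) ^ 4)"
      using PX(1) PY(1) by (simp_all add: power_mult_distrib mult.commute)
    show d_int: "integrable M (\<lambda>\<omega>. d k \<omega> ^ 4)"
      unfolding d_def using int' k meas[OF k] Umeas[of k] by (intro integrable_power4_add) auto
    have "d k \<omega> ^ 4 \<le> 8 * ((X k \<omega> * ?U k \<omega>) ^ 4 + (Y k \<omega> * ?V k \<omega>) ^ 4)" for \<omega>
      unfolding d_def by (rule power4_add_le)
    hence "expectation (\<lambda>\<omega>. d k \<omega> ^ 4)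
        \<le> expectation (\<lambda>\<omega>. 8 * ((X k \<omega> * ?U k \<omega>) ^ 4 + (Y k \<omega> * ?V k \<omega>) ^ 4))"
      using d_int int' by (intro integral_mono) auto
    also have "\<dots> = 8 * (expectation (\<lambda>\<omega>. ?U k \<omega> ^ 4) * expectation (\<lambda>\<omega>. X k \<omega> ^ 4)
         + expectation (\<lambda>\<omega>. ?V k \<omega> ^ 4) * expectation (\<lambda>\<omega>. Y k \<omega> ^ 4))"
      using int' PX(2) PY(2) by (simp add: power_mult_distrib mult.commute)
    also have "\<dots> \<le> 8 * (4 * m\<^sup>2 * L\<^sup>2 * m + 4 * m\<^sup>2 * L\<^sup>2 * m)"
      using UV[OF k] m(1,2)[OF k] m(3)
      by (intro mult_left_mono add_mono mult_mono) auto
    also have "\<dots> = ?C" by (simp add: power2_eq_square power3_eq_cube)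
    finally show "expectation (\<lambda>\<omega>. d k \<omega> ^ 4) \<le> ?C" .
  qed

  have "integrable M (\<lambda>\<omega>. S k \<omega> ^ 4) \<and> expectation (\<lambda>\<omega>. S k \<omega> ^ 4) \<le> 16 * ?C * (real k)\<^sup>2"
    using \<open>k \<le> n\<close>
  proof (induction k)
    case 0
    show ?case by (simp add: S_def)
  next
    case (Suc k)
    hence k: "k < n" and IH: "integrable M (\<lambda>\<omega>. S k \<omega> ^ 4)"
      "expectation (\<lambda>\<omega>. S k \<omega> ^ 4) \<le> 16 * ?C * (real k)\<^sup>2" by auto
    have Suc_int: "integrable M (\<lambda>\<omega>. S (Suc k) \<omega> ^ 4)"
      unfolding S_Suc using k Smeas[of k] dmeas[of k] d4[of k] IH by (intro integrable_power4_add) auto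
    have S3: "integrable M (\<lambda>\<omega>. S k \<omega> ^ 3 * Z \<omega> * R \<omega>)"
      "expectation (\<lambda>\<omega>. S k \<omega> ^ 3 * Z \<omega> * R \<omega>) = 0"
      if "Z \<in> borel_measurable M" "integrable M (\<lambda>\<omega>. Z \<omega> ^ 4)" "integrable M R" "expectation R = 0"
        "indep_var borel (\<lambda>\<omega>. S k \<omega> ^ 3 * Z \<omega>) borel R" for Z R
    proof -
      have "integrable M (\<lambda>\<omega>. S k \<omega> ^ 3 * Z \<omega>)"
      proof (rule Bochner_Integration.integrable_bound)
        show "integrable M (\<lambda>\<omega>. S k \<omega> ^ 4 + Z \<omega> ^ 4)" using IH that by simp
        show "AE \<omega> in M. norm (S k \<omega> ^ 3 * Z \<omega>) \<le> norm (S k \<omega> ^ 4 + Z \<omega> ^ 4)"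
          by (intro AE_I2) (use abs_cube_mult_le in \<open>auto intro: order_trans[OF _ abs_ge_self]\<close>)
        show "(\<lambda>\<omega>. S k \<omega> ^ 3 * Z \<omega>) \<in> borel_measurable M"
          using Smeas[of k] k that(1) by (intro borel_measurable_times borel_measurable_power) auto
      qed
      from indep_var_integrable[OF that(5) this that(3)] indep_var_lebesgue_integral[OF that(5) this that(3)]
      show "integrable M (\<lambda>\<omega>. S k \<omega> ^ 3 * Z \<omega> * R \<omega>)"
        "expectation (\<lambda>\<omega>. S k \<omega> ^ 3 * Z \<omega> * R \<omega>) = 0"
        using that(4) by simp_all
    qed
    have F: "(\<lambda>(s, z). s ^ 3 * z) \<in> borel_measurable (borel :: (real \<times> real) measure)"
      using fst snd unfolding case_prod_unfold by measurable
    have intXY: "integrable M (X k)" "integrable M (Y k)"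
      using integrable_power_if_integrable_power4[of "X k" 1]
        integrable_power_if_integrable_power4[of "Y k" 1] int meas k by auto
    note SU = S3[OF Umeas(1)[OF less_imp_le[OF k]] UV(1)[OF k] intXY(1) mean(1)[OF k] step(1)[OF k F]]
    note SV = S3[OF Umeas(2)[OF less_imp_le[OF k]] UV(3)[OF k] intXY(2) mean(2)[OF k] step(2)[OF k F]]
    have S3d: "S k \<omega> ^ 3 * d k \<omega> = S k \<omega> ^ 3 * ?U k \<omega> * X k \<omega> + S k \<omega> ^ 3 * ?V k \<omega> * Y k \<omega>" for \<omega>
      by (simp add: d_def algebra_simps)
    have orth: "integrable M (\<lambda>\<omega>. S k \<omega> ^ 3 * d k \<omega>)" "expectation (\<lambda>\<omega>. S k \<omega> ^ 3 * d k \<omega>) = 0"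
      unfolding S3d using SU SV by simp_all
    have "expectation (\<lambda>\<omega>. S (Suc k) \<omega> ^ 4) \<le> 16 * ?C * (real (Suc k))\<^sup>2"
    \<comment> \<open>The recursion divides by \<open>k\<close>; the first step has no past and needs only the increment.\<close>
    proof (cases "k = 0")
      case True
      have "S (Suc k) \<omega> = d k \<omega>" for \<omega> by (simp add: True S_def d_def)
      hence "expectation (\<lambda>\<omega>. S (Suc k) \<omega> ^ 4) \<le> ?C" using d4(2)[OF k] by simp
      also have "?C \<le> 16 * ?C * 1" using C0 by linarith
      finally show ?thesis using True by simp
    next
      case False
      have "expectation (\<lambda>\<omega>. S (Suc k) \<omega> ^ 4) \<le> expectation (\<lambda>\<omega>. (1 + 1 / real k) * S k \<omega> ^ 4
          + 4 * (S k \<omega> ^ 3 * d k \<omega>) + (16 * real k + 3) * d k \<omega> ^ 4)"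
        using Suc_int IH(1) orth(1) d4(1)[OF k] False power4_add_expand_le[of "real k"]
        by (intro integral_mono Bochner_Integration.integrable_add integrable_mult_right)
          (auto simp: S_Suc)
      also have "\<dots> = (1 + 1 / real k) * expectation (\<lambda>\<omega>. S k \<omega> ^ 4)
          + (16 * real k + 3) * expectation (\<lambda>\<omega>. d k \<omega> ^ 4)"
        using IH(1) orth d4(1)[OF k] by simp
      also have "\<dots> \<le> (1 + 1 / real k) * (16 * ?C * (real k)\<^sup>2) + (16 * real k + 3) * ?C"
        using IH(2) d4(2)[OF k] by (intro add_mono mult_left_mono) auto
      also have "\<dots> = ?C * (16 * (real k)\<^sup>2 + 32 * real k + 3)"
        using False by (simp add: field_simps power2_eq_square)
      also have "\<dots> \<le> ?C * (16 * (real (Suc k))\<^sup>2)"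
        using C0 by (intro mult_left_mono) (auto simp: power2_eq_square algebra_simps)
      finally show ?thesis by (simp only: mult_ac)
    qed
    with Suc_int show ?case by blast
  qed
  thus "integrable M (\<lambda>\<omega>. S k \<omega> ^ 4)"
    and "expectation (\<lambda>\<omega>. S k \<omega> ^ 4) \<le> 1024 * m ^ 3 * L\<^sup>2 * (real k)\<^sup>2"
    by auto
qed

section \<open>Bilinear forms in random vectors\<close>

lemma double_sum_diagonal_split:
  fixes c :: "nat \<Rightarrow> nat \<Rightarrow> real"
  shows "(\<Sum>i<n. \<Sum>j<n. f i * c i j * g j) = (\<Sum>i<n. c i i * (f i * g i))
     + (\<Sum>i<n. f i * (\<Sum>j<i. c i j * g j) + g i * (\<Sum>j<i. c j i * f j))"
  by (induction n) (simp_all add: sum.distrib sum_distrib_left mult_ac)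

text \<open>The diagonal part is an average of weighted independent products and concentrates at the
covariance times the normalised trace. The off-diagonal part, divided by \<open>n\<close>, has a fourth moment
of order \<open>n powr (-2)\<close> and vanishes in the limit.\<close>
lemma (in prob_space) bilinear_form_strong_law:
  fixes X Y :: "nat \<Rightarrow> nat \<Rightarrow> 'a \<Rightarrow> real" and c :: "nat \<Rightarrow> nat \<Rightarrow> nat \<Rightarrow> real"
  assumes q: "2 < q" "q \<le> 4"
    and indep: "\<And>n. indep_vars (\<lambda>_. borel) (\<lambda>i \<omega>. (X n i \<omega>, Y n i \<omega>)) {..<n}"
    and mean: "\<And>n i. i < n \<Longrightarrow> expectation (X n i) = 0" "\<And>n i. i < n \<Longrightarrow> expectation (Y n i) = 0"
    and X: "\<And>n i. i < n \<Longrightarrow> integrable M (\<lambda>\<omega>. \<bar>X n i \<omega>\<bar> powr (2 * q))"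
      "\<And>n i. i < n \<Longrightarrow> expectation (\<lambda>\<omega>. \<bar>X n i \<omega>\<bar> powr (2 * q)) \<le> m"
    and Y: "\<And>n i. i < n \<Longrightarrow> integrable M (\<lambda>\<omega>. \<bar>Y n i \<omega>\<bar> powr (2 * q))"
      "\<And>n i. i < n \<Longrightarrow> expectation (\<lambda>\<omega>. \<bar>Y n i \<omega>\<bar> powr (2 * q)) \<le> m"
    and cov: "\<And>n i. i < n \<Longrightarrow> expectation (\<lambda>\<omega>. X n i \<omega> * Y n i \<omega>) = \<rho>"
    and row: "\<And>n i. i < n \<Longrightarrow> (\<Sum>j<n. (c n i j)\<^sup>2) \<le> L"
    and col: "\<And>n j. j < n \<Longrightarrow> (\<Sum>i<n. (c n i j)\<^sup>2) \<le> L"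
  shows "AE \<omega> in M. (\<lambda>n. (\<Sum>i<n. \<Sum>j<n. X n i \<omega> * c n i j * Y n j \<omega>) / real n
            - \<rho> * (\<Sum>i<n. c n i i) / real n) \<longlonglongrightarrow> 0"
proof -
  define S where "S = (\<lambda>n \<omega>. \<Sum>i<n. X n i \<omega> * (\<Sum>j<i. c n i j * Y n j \<omega>)
      + Y n i \<omega> * (\<Sum>j<i. c n j i * X n j \<omega>))"
  have partial: "(\<Sum>j<i. (c n i j)\<^sup>2) \<le> L" "(\<Sum>j<i. (c n j i)\<^sup>2) \<le> L" if "i < n" for n i
    using that by (auto intro!: order_trans[OF sum_mono2 row] order_trans[OF sum_mono2 col])
  have diag: "\<bar>c n i i\<bar> \<le> sqrt L" if "i < n" for n i
  proof -
    have "(c n i i)\<^sup>2 \<le> (\<Sum>j<n. (c n i j)\<^sup>2)"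
      using that by (intro member_le_sum) auto
    also note row[OF that]
    finally show ?thesis using real_sqrt_le_mono[of "(c n i i)\<^sup>2" L] by simp
  qed
  have m0: "0 \<le> m" by (rule order_trans[OF _ X(2)[of 0 1]]) auto
  have four: "integrable M (\<lambda>\<omega>. f \<omega> ^ 4)" "expectation (\<lambda>\<omega>. f \<omega> ^ 4) \<le> 1 + m"
    if "f \<in> borel_measurable M" "integrable M (\<lambda>\<omega>. \<bar>f \<omega>\<bar> powr (2 * q))"
      "expectation (\<lambda>\<omega>. \<bar>f \<omega>\<bar> powr (2 * q)) \<le> m" for f
  proof -
    have "\<bar>f \<omega>\<bar> powr 4 = f \<omega> ^ 4" for \<omega> by (simp add: powr_numeral)
    with expectation_powr_le[OF that(1,2), of 4] q that(3)
    show "integrable M (\<lambda>\<omega>. f \<omega> ^ 4)" "expectation (\<lambda>\<omega>. f \<omega> ^ 4) \<le> 1 + m" by auto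
  qed
  note XY4 = four[OF indep_vars_pairD(1)[OF indep]] four[OF indep_vars_pairD(2)[OF indep]]
  have off: "integrable M (\<lambda>\<omega>. S n \<omega> ^ 4)"
    "expectation (\<lambda>\<omega>. S n \<omega> ^ 4) \<le> 1024 * (1 + m) ^ 3 * L\<^sup>2 * (real n)\<^sup>2" for n
    unfolding S_def using X Y m0 XY4 partial mean
    by (auto intro!: off_diagonal_power4_le[OF indep, where m="1 + m"])

  have "AE \<omega> in M. (\<lambda>n. (S n \<omega> / real n) ^ 4) \<longlonglongrightarrow> 0"
  proof (rule AE_tendsto_zero_if_summable_expectation)
    show "integrable M (\<lambda>\<omega>. (S n \<omega> / real n) ^ 4)" for n
      using off(1) by (simp add: power_divide)
    show "expectation (\<lambda>\<omega>. (S n \<omega> / real n) ^ 4) \<le> 1024 * (1 + m) ^ 3 * L\<^sup>2 * real n powr (-2)" for n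
    proof (cases "n = 0")
      case False
      have "expectation (\<lambda>\<omega>. (S n \<omega> / real n) ^ 4) = expectation (\<lambda>\<omega>. S n \<omega> ^ 4) / real n ^ 4"
        by (simp add: power_divide)
      also have "\<dots> \<le> 1024 * (1 + m) ^ 3 * L\<^sup>2 * (real n)\<^sup>2 / real n ^ 4"
        using off(2) by (intro divide_right_mono) auto
      also have "\<dots> = 1024 * (1 + m) ^ 3 * L\<^sup>2 * (1 / (real n)\<^sup>2)"
        using False by (simp add: field_simps power4_eq_xxxx power2_eq_square)
      also have "1 / (real n)\<^sup>2 = real n powr (-2)"
        using False powr_minus[of "real n" 2] by (simp add: powr_numeral divide_inverse)
      finally show ?thesis .
    qed simp
    show "summable (\<lambda>n. 1024 * (1 + m) ^ 3 * L\<^sup>2 * real n powr (-2))"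
      by (intro summable_mult summable_nat_powr) auto
  qed simp
  moreover have "AE \<omega> in M. (\<lambda>n. (\<Sum>i<n. c n i i * (X n i \<omega> * Y n i \<omega>)
            - c n i i * expectation (\<lambda>\<omega>. X n i \<omega> * Y n i \<omega>)) / real n) \<longlonglongrightarrow> 0"
    by (rule weighted_products_strong_law[OF q indep X Y diag])
  ultimately show ?thesis
  proof eventually_elim
    case (elim \<omega>)
    have "(\<lambda>n. S n \<omega> / real n) \<longlonglongrightarrow> 0"
      by (rule power_tendsto_0_iff[THEN iffD1, OF _ elim(1)]) simp
    from tendsto_add[OF elim(2) this]
    have lim: "(\<lambda>n. (\<Sum>i<n. c n i i * (X n i \<omega> * Y n i \<omega>)
            - c n i i * expectation (\<lambda>\<omega>. X n i \<omega> * Y n i \<omega>)) / real n + S n \<omega> / real n) \<longlonglongrightarrow> 0"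
      by simp
    have "(\<Sum>i<n. c n i i * expectation (\<lambda>\<omega>. X n i \<omega> * Y n i \<omega>)) = \<rho> * (\<Sum>i<n. c n i i)" for n
      by (simp add: cov sum_distrib_left mult.commute)
    thus ?case
      using lim unfolding double_sum_diagonal_split S_def
      by (simp add: sum_subtractf diff_divide_distrib add_divide_distrib algebra_simps)
  qed
qed

section \<open>The spectral norm and rescaled vectors\<close>

lemma scalar_prod_mult_mat_vec_eq_sum:
  assumes "u \<in> carrier_vec n" "v \<in> carrier_vec m" "A \<in> carrier_mat n m"
  shows "u \<bullet> (A *\<^sub>v v) = (\<Sum>i<n. \<Sum>j<m. u $ i * A $$ (i, j) * v $ j)"
proof -
  have "u \<bullet> (A *\<^sub>v v) = (\<Sum>i<n. u $ i * (A *\<^sub>v v) $ i)"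
    using assms by (auto simp: scalar_prod_def lessThan_atLeast0)
  also have "\<dots> = (\<Sum>i<n. \<Sum>j<m. u $ i * A $$ (i, j) * v $ j)"
    using assms by (intro sum.cong refl)
      (auto simp: scalar_prod_def lessThan_atLeast0 sum_distrib_left mult.assoc)
  finally show ?thesis .
qed

lemma eucl_norm_eq_sum:
  assumes "v \<in> carrier_vec n"
  shows "eucl_norm v = sqrt (\<Sum>i<n. (v $ i)\<^sup>2)"
  using assms by (auto simp: eucl_norm_def scalar_prod_def lessThan_atLeast0 power2_eq_square)

text \<open>A supremum of real numbers dominates its members only if the set is bounded above; the Frobenius
norm serves as the bound, by the Cauchy-Schwarz inequality in each row.\<close>
lemma eucl_norm_mult_le_spectral_norm:
  assumes A: "A \<in> carrier_mat n m" and v: "v \<in> carrier_vec m" "eucl_norm v \<le> 1"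
  shows "eucl_norm (A *\<^sub>v v) \<le> spectral_norm A"
  unfolding spectral_norm_def
proof (rule cSUP_upper)
  show "v \<in> {v \<in> carrier_vec (dim_col A). eucl_norm v \<le> 1}" using assms by auto
  show "bdd_above ((\<lambda>v. eucl_norm (A *\<^sub>v v)) ` {v \<in> carrier_vec (dim_col A). eucl_norm v \<le> 1})"
  proof (rule bdd_aboveI2)
    fix w assume "w \<in> {v \<in> carrier_vec (dim_col A). eucl_norm v \<le> 1}"
    hence w: "w \<in> carrier_vec m" "eucl_norm w \<le> 1" using A by auto
    hence w1: "(\<Sum>j<m. (w $ j)\<^sup>2) \<le> 1"
      by (simp add: eucl_norm_eq_sum)
    have "eucl_norm (A *\<^sub>v w) = sqrt (\<Sum>i<n. ((A *\<^sub>v w) $ i)\<^sup>2)"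
      by (intro eucl_norm_eq_sum mult_mat_vec_carrier[OF A w(1)])
    also have "\<dots> \<le> sqrt (\<Sum>i<n. \<Sum>j<m. (A $$ (i, j))\<^sup>2)"
    proof (intro real_sqrt_le_mono sum_mono)
      fix i assume "i \<in> {..<n}"
      hence "(A *\<^sub>v w) $ i = (\<Sum>j<m. A $$ (i, j) * w $ j)"
        using A w(1) by (auto simp: scalar_prod_def lessThan_atLeast0)
      hence "((A *\<^sub>v w) $ i)\<^sup>2 \<le> (\<Sum>j<m. (A $$ (i, j))\<^sup>2) * (\<Sum>j<m. (w $ j)\<^sup>2)"
        by (simp add: Cauchy_Schwarz_ineq_sum)
      also have "\<dots> \<le> (\<Sum>j<m. (A $$ (i, j))\<^sup>2) * 1"
        using w1 by (intro mult_left_mono sum_nonneg) auto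
      finally show "((A *\<^sub>v w) $ i)\<^sup>2 \<le> (\<Sum>j<m. (A $$ (i, j))\<^sup>2)" by simp
    qed
    finally show "eucl_norm (A *\<^sub>v w) \<le> sqrt (\<Sum>i<n. \<Sum>j<m. (A $$ (i, j))\<^sup>2)" .
  qed
qed

text \<open>A column is the image of a unit vector.\<close>
lemma column_norm_le_spectral_norm:
  assumes A: "A \<in> carrier_mat n m" and j: "j < m"
  shows "(\<Sum>i<n. (A $$ (i, j))\<^sup>2) \<le> (spectral_norm A)\<^sup>2"
proof -
  let ?e = "unit_vec m j :: real vec"
  have e: "?e \<in> carrier_vec m" by simp
  have "eucl_norm ?e = 1" using j by (simp add: eucl_norm_def)
  hence "eucl_norm (A *\<^sub>v ?e) \<le> spectral_norm A"
    by (intro eucl_norm_mult_le_spectral_norm[OF A e]) simp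
  moreover have "eucl_norm (A *\<^sub>v ?e) = sqrt (\<Sum>i<n. (A $$ (i, j))\<^sup>2)"
  proof -
    have "(A *\<^sub>v ?e) $ i = A $$ (i, j)" if "i < n" for i
      using A j that by simp
    moreover have "A *\<^sub>v ?e \<in> carrier_vec n" by (rule mult_mat_vec_carrier[OF A e])
    ultimately show ?thesis by (simp add: eucl_norm_eq_sum)
  qed
  ultimately have "sqrt (\<Sum>i<n. (A $$ (i, j))\<^sup>2) \<le> spectral_norm A" by simp
  hence "(sqrt (\<Sum>i<n. (A $$ (i, j))\<^sup>2))\<^sup>2 \<le> (spectral_norm A)\<^sup>2"
    by (intro power_mono) (auto intro: sum_nonneg)
  thus ?thesis by (simp add: sum_nonneg)
qed

text \<open>If \<open>u\<close> or \<open>v\<close> is zero, the right-hand side is a quotient with denominator zero, hence zero, which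
agrees with the convention that a zero vector is rescaled to itself. So no case distinction remains
in the limit argument.\<close>
lemma rescaled_bilinear_form:
  assumes u: "u \<in> carrier_vec n" and v: "v \<in> carrier_vec n" and A: "A \<in> carrier_mat n n"
  shows "1 / real n * (rescale_vec u \<bullet> (A *\<^sub>v rescale_vec v))
     = (\<Sum>i<n. \<Sum>j<n. u $ i * A $$ (i, j) * v $ j) / real n
         / (sqrt ((\<Sum>i<n. (u $ i)\<^sup>2) / real n) * sqrt ((\<Sum>i<n. (v $ i)\<^sup>2) / real n))"
proof (cases "n = 0")
  case False
  have rescale: "rescale_vec w = (sqrt (real n) / eucl_norm w) \<cdot>\<^sub>v w" if "w \<in> carrier_vec n" for w
    using that by (auto simp: rescale_vec_def)
  have Av: "A *\<^sub>v v \<in> carrier_vec n" by (rule mult_mat_vec_carrier[OF A v])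
  have "rescale_vec u \<bullet> (A *\<^sub>v rescale_vec v)
      = sqrt (real n) / eucl_norm u * (sqrt (real n) / eucl_norm v * (u \<bullet> (A *\<^sub>v v)))"
    using u v A Av by (simp add: rescale mult_mat_vec)
  moreover have "1 / real n * (s / a * (s / b * r)) = r / real n / ((a / s) * (b / s))"
    if "real n = s * s" for a b r s :: real
    using that False by (simp add: field_simps)
  from this[of "sqrt (real n)"] have "1 / real n * (sqrt (real n) / eucl_norm u * (sqrt (real n) / eucl_norm v * (u \<bullet> (A *\<^sub>v v))))
      = u \<bullet> (A *\<^sub>v v) / real n / (eucl_norm u / sqrt (real n) * (eucl_norm v / sqrt (real n)))"
    by simp
  ultimately show ?thesis
    by (simp only: eucl_norm_eq_sum[OF u] eucl_norm_eq_sum[OF v] real_sqrt_divide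
        scalar_prod_mult_mat_vec_eq_sum[OF u v A])
qed simp

lemma tendsto_quotient_diff_zero:
  fixes Q t u v :: "nat \<Rightarrow> real"
  assumes Q: "(\<lambda>n. Q n - t n) \<longlonglongrightarrow> 0" and t: "\<And>n. \<bar>t n\<bar> \<le> K"
    and u: "u \<longlonglongrightarrow> 1" and v: "v \<longlonglongrightarrow> 1"
  shows "(\<lambda>n. Q n / (sqrt (u n) * sqrt (v n)) - t n) \<longlonglongrightarrow> 0"
proof -
  define w where "w = (\<lambda>n. 1 / (sqrt (u n) * sqrt (v n)))"
  have w: "w \<longlonglongrightarrow> 1"
    unfolding w_def by (rule tendsto_eq_intros u v refl | simp)+
  hence "(\<lambda>n. w n - 1) \<longlonglongrightarrow> 0" using tendsto_diff[OF w tendsto_const[of 1]] by simp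
  hence "(\<lambda>n. (w n - 1) * t n) \<longlonglongrightarrow> 0"
    using t by (intro lim_null_mult_right_bounded[where B=K]) auto
  moreover have "(\<lambda>n. (Q n - t n) * w n) \<longlonglongrightarrow> 0 * 1" by (intro tendsto_mult Q w)
  ultimately have "(\<lambda>n. (Q n - t n) * w n + (w n - 1) * t n) \<longlonglongrightarrow> 0 * 1 + 0"
    by (intro tendsto_add)
  moreover have "(Q n - t n) * w n + (w n - 1) * t n = Q n * w n - t n" for n
    by (simp add: algebra_simps)
  ultimately show ?thesis by (simp add: w_def)
qed

section \<open>The rescaled bilinear form\<close>

theorem corollary7:
  fixes M :: "'a measure"
    and x y :: "nat \<Rightarrow> 'a \<Rightarrow> real vec"
    and B :: "nat \<Rightarrow> real mat"
    and \<mu> :: "(real \<times> real) measure"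
    and \<rho> \<delta> :: real
  assumes "prob_space M"
    and "\<And>n \<omega>. \<omega> \<in> space M \<Longrightarrow> x n \<omega> \<in> carrier_vec n"
    and "\<And>n \<omega>. \<omega> \<in> space M \<Longrightarrow> y n \<omega> \<in> carrier_vec n"
    and indep: "\<And>n. prob_space.indep_vars M (\<lambda>_. borel)
                  (\<lambda>i \<omega>. (x n \<omega> $ i, y n \<omega> $ i)) {..<n}"
    and law: "\<And>n i. i < n \<Longrightarrow> distr M borel (\<lambda>\<omega>. (x n \<omega> $ i, y n \<omega> $ i)) = \<mu>"
    and mean_x: "\<And>n i. i < n \<Longrightarrow> prob_space.expectation M (\<lambda>\<omega>. x n \<omega> $ i) = 0"
    and mean_y: "\<And>n i. i < n \<Longrightarrow> prob_space.expectation M (\<lambda>\<omega>. y n \<omega> $ i) = 0"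
    and var_x: "\<And>n i. i < n \<Longrightarrow> prob_space.variance M (\<lambda>\<omega>. x n \<omega> $ i) = 1"
    and var_y: "\<And>n i. i < n \<Longrightarrow> prob_space.variance M (\<lambda>\<omega>. y n \<omega> $ i) = 1"
    and "\<delta> > 0"
    and mom_x: "\<And>n i. i < n \<Longrightarrow> integrable M (\<lambda>\<omega>. \<bar>x n \<omega> $ i\<bar> powr (4 + \<delta>))"
    and mom_y: "\<And>n i. i < n \<Longrightarrow> integrable M (\<lambda>\<omega>. \<bar>y n \<omega> $ i\<bar> powr (4 + \<delta>))"
    and cov: "\<And>n i. i < n \<Longrightarrow> prob_space.expectation M (\<lambda>\<omega>. (x n \<omega> $ i) * (y n \<omega> $ i)) = \<rho>"
    and "\<And>n. B n \<in> carrier_mat n n"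
    and "\<And>n. symmetric_mat (B n)"
    and "bounded (range (\<lambda>n. spectral_norm (B n)))"
  shows "AE \<omega> in M.
    (\<lambda>n. 1 / real n * (rescale_vec (x n \<omega>) \<bullet> (B n *\<^sub>v rescale_vec (y n \<omega>)))
         - 1 / real n * \<rho> * mat_trace (B n)) \<longlonglongrightarrow> 0"
proof -
  interpret prob_space M by fact
  note carrier_x = assms(2) and carrier_y = assms(3) and carrier_B = assms(14) and sym_B = assms(15)
  \<comment> \<open>A moment of order \<open>2 * q\<close> with \<open>q > 2\<close> suffices; capping \<open>\<delta>\<close> at 4 keeps \<open>q\<close> at most 4, as the
    fourth moment method requires.\<close>
  define p where "p = 4 + \<delta>"
  define q where "q = 2 + min \<delta> 4 / 2"
  have q: "2 < q" "q \<le> 4" "2 * q \<le> p" using \<open>\<delta> > 0\<close> by (auto simp: q_def p_def)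
  have pair [measurable]: "(\<lambda>\<omega>. (x n \<omega> $ i, y n \<omega> $ i)) \<in> borel_measurable M" if "i < n" for n i
    using indep[of n] that unfolding indep_vars_def by auto
  note meas = indep_vars_pairD(1)[OF indep] indep_vars_pairD(2)[OF indep]

  \<comment> \<open>All pairs have the law of the pair with index 0 in dimension 1, so its moments bound the others.\<close>
  define m where "m = 1 + expectation (\<lambda>\<omega>. \<bar>x 1 \<omega> $ 0\<bar> powr p) + expectation (\<lambda>\<omega>. \<bar>y 1 \<omega> $ 0\<bar> powr p)"
  have same_law: "expectation (\<lambda>\<omega>. h (x n \<omega> $ i, y n \<omega> $ i)) = expectation (\<lambda>\<omega>. h (x 1 \<omega> $ 0, y 1 \<omega> $ 0))"
    if i: "i < n" and h: "h \<in> borel_measurable borel" for h :: "real \<times> real \<Rightarrow> real" and n i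
  proof -
    have "expectation (\<lambda>\<omega>. h (x n \<omega> $ i, y n \<omega> $ i)) = integral\<^sup>L \<mu> h" if "i < n" for n i
      using integral_distr[OF pair[OF that] h] law[OF that] by simp
    from this[OF i] this[of 0 1] show ?thesis by simp
  qed
  have moment: "integrable M (\<lambda>\<omega>. \<bar>x n \<omega> $ i\<bar> powr (2 * q))"
      "expectation (\<lambda>\<omega>. \<bar>x n \<omega> $ i\<bar> powr (2 * q)) \<le> m"
      "integrable M (\<lambda>\<omega>. \<bar>y n \<omega> $ i\<bar> powr (2 * q))"
      "expectation (\<lambda>\<omega>. \<bar>y n \<omega> $ i\<bar> powr (2 * q)) \<le> m" if i: "i < n" for n i
  proof -
    have hx: "(\<lambda>z. \<bar>fst z\<bar> powr p) \<in> borel_measurable (borel :: (real \<times> real) measure)"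
      and hy: "(\<lambda>z. \<bar>snd z\<bar> powr p) \<in> borel_measurable (borel :: (real \<times> real) measure)"
      using borel_measurable_real_pair by measurable
    have "expectation (\<lambda>\<omega>. \<bar>x n \<omega> $ i\<bar> powr p) = expectation (\<lambda>\<omega>. \<bar>x 1 \<omega> $ 0\<bar> powr p)"
      "expectation (\<lambda>\<omega>. \<bar>y n \<omega> $ i\<bar> powr p) = expectation (\<lambda>\<omega>. \<bar>y 1 \<omega> $ 0\<bar> powr p)"
      using same_law[OF i hx] same_law[OF i hy] by simp_all
    moreover have "0 \<le> expectation (\<lambda>\<omega>. \<bar>x 1 \<omega> $ 0\<bar> powr p)" "0 \<le> expectation (\<lambda>\<omega>. \<bar>y 1 \<omega> $ 0\<bar> powr p)"
      by simp_all
    ultimately have le: "1 + expectation (\<lambda>\<omega>. \<bar>x n \<omega> $ i\<bar> powr p) \<le> m"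
      "1 + expectation (\<lambda>\<omega>. \<bar>y n \<omega> $ i\<bar> powr p) \<le> m"
      unfolding m_def by linarith+
    have meas_i: "(\<lambda>\<omega>. x n \<omega> $ i) \<in> borel_measurable M" "(\<lambda>\<omega>. y n \<omega> $ i) \<in> borel_measurable M"
      using meas i by auto
    have q0: "0 \<le> 2 * q" using q(1) by simp
    note mx = expectation_powr_le[OF meas_i(1) mom_x[OF i, folded p_def] q0 q(3)]
    note my = expectation_powr_le[OF meas_i(2) mom_y[OF i, folded p_def] q0 q(3)]
    show "integrable M (\<lambda>\<omega>. \<bar>x n \<omega> $ i\<bar> powr (2 * q))" by (rule mx(1))
    show "integrable M (\<lambda>\<omega>. \<bar>y n \<omega> $ i\<bar> powr (2 * q))" by (rule my(1))
    show "expectation (\<lambda>\<omega>. \<bar>x n \<omega> $ i\<bar> powr (2 * q)) \<le> m" by (rule order_trans[OF mx(2) le(1)])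
    show "expectation (\<lambda>\<omega>. \<bar>y n \<omega> $ i\<bar> powr (2 * q)) \<le> m" by (rule order_trans[OF my(2) le(2)])
  qed

  obtain K where K: "\<And>n. \<bar>spectral_norm (B n)\<bar> \<le> K"
    using assms(16) unfolding bounded_iff by auto
  have K0: "0 \<le> K" using K[of 0] by linarith
  have col: "(\<Sum>i<n. (B n $$ (i, j))\<^sup>2) \<le> K\<^sup>2" if "j < n" for n j
  proof -
    have "(spectral_norm (B n))\<^sup>2 \<le> K\<^sup>2"
      using K[of n] K0 by (intro abs_le_square_iff[THEN iffD1]) auto
    with column_norm_le_spectral_norm[OF carrier_B that] show ?thesis by linarith
  qed
  have row: "(\<Sum>j<n. (B n $$ (i, j))\<^sup>2) \<le> K\<^sup>2" if "i < n" for n i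
  proof -
    have "B n $$ (i, j) = B n $$ (j, i)" if "j < n" for j
      using carrier_B[of n] sym_B[of n] \<open>i < n\<close> that index_transpose_mat(1)[of i "B n" j]
      by (auto simp: symmetric_mat_def)
    thus ?thesis using col[OF that] by simp
  qed
  have diag: "\<bar>B n $$ (i, i)\<bar> \<le> K" if "i < n" for n i
  proof -
    have "(B n $$ (i, i))\<^sup>2 \<le> (\<Sum>j<n. (B n $$ (i, j))\<^sup>2)"
      using that by (intro member_le_sum) auto
    also have "\<dots> \<le> K\<^sup>2" by (rule row[OF that])
    finally show ?thesis using K0 abs_le_square_iff[of "B n $$ (i, i)" K] by simp
  qed
  have trace: "mat_trace (B n) = (\<Sum>i<n. B n $$ (i, i))" for n
    using carrier_B[of n] by (auto simp: mat_trace_def)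
  have trace_bound: "\<bar>\<rho> * mat_trace (B n) / real n\<bar> \<le> \<bar>\<rho>\<bar> * K" for n
  proof (cases "n = 0")
    case False
    have "\<bar>mat_trace (B n)\<bar> \<le> (\<Sum>i<n. K)"
      unfolding trace using diag by (intro order_trans[OF sum_abs] sum_mono) auto
    hence "\<bar>mat_trace (B n)\<bar> / real n \<le> K" using False by (simp add: field_simps)
    hence "\<bar>\<rho>\<bar> * (\<bar>mat_trace (B n)\<bar> / real n) \<le> \<bar>\<rho>\<bar> * K" by (intro mult_left_mono) auto
    thus ?thesis by (simp add: abs_mult)
  qed (use K0 in simp)

  have second_x: "expectation (\<lambda>\<omega>. (x n \<omega> $ i)\<^sup>2) = 1"
    and second_y: "expectation (\<lambda>\<omega>. (y n \<omega> $ i)\<^sup>2) = 1" if "i < n" for n i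
    using var_x[OF that] var_y[OF that] mean_x[OF that] mean_y[OF that] by simp_all

  have "AE \<omega> in M. (\<lambda>n. (\<Sum>i<n. \<Sum>j<n. x n \<omega> $ i * B n $$ (i, j) * y n \<omega> $ j) / real n
      - \<rho> * (\<Sum>i<n. B n $$ (i, i)) / real n) \<longlonglongrightarrow> 0"
    by (rule bilinear_form_strong_law[OF q(1,2) indep mean_x mean_y moment cov row col])
  moreover have "AE \<omega> in M. (\<lambda>n. (\<Sum>i<n. (x n \<omega> $ i)\<^sup>2) / real n) \<longlonglongrightarrow> 1"
    by (rule mean_square_strong_law[OF q(1,2) indep_vars_pair_components(1)[OF indep] moment(1,2) second_x])
  moreover have "AE \<omega> in M. (\<lambda>n. (\<Sum>i<n. (y n \<omega> $ i)\<^sup>2) / real n) \<longlonglongrightarrow> 1"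
    by (rule mean_square_strong_law[OF q(1,2) indep_vars_pair_components(2)[OF indep] moment(3,4) second_y])
  ultimately show ?thesis
    using AE_space
  proof eventually_elim
    case (elim \<omega>)
    note lim = tendsto_quotient_diff_zero[OF elim(1)[folded trace] trace_bound elim(2,3)]
    show ?case
      unfolding rescaled_bilinear_form[OF carrier_x[OF elim(4)] carrier_y[OF elim(4)] carrier_B]
      using lim by (simp add: mult.assoc)
  qed
qed

end
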